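(* Let $X$ be a compact complex manifold of complex dimension $n$. For all $p,q$ there is a decomposition (isomorphism of complex vector spaces) $$\ker\left(\partial:H^{p,q}_{\bar\partial}\to H^{p+1,q}_{\bar\partial}\right)\cong\left(G^{p,q}_{\partial}\sqcap\left(H^{p,q}_{\bar\partial}/\operatorname{im}(\partial)\right)\right)\oplus K^{p,q}\oplus\partial L^{p-1,q}_{\partial}.$$
   Context: On smooth complex-valued $(p,q)$-forms on $X$, define $H^{p,q}_A=\ker(\partial\bar\partial)/(\operatorname{im}(\partial)+\operatorname{im}(\bar\partial))$, $H^{p,q}_{\bar\partial}=\ker(\bar\partial)/\operatorname{im}(\bar\partial)$, $H^{p,q}_{\partial}=\ker(\partial)/\operatorname{im}(\partial)$ and $$K^{p,q}=\frac{\ker(\partial)\cap\ker(\bar\partial)}{\operatorname{im}(\partial)\cap\ker(\bar\partial)+\operatorname{im}(\bar\partial)\cap\ker(\partial)}$$ (all spaces in bidegree $(p,q)$, zero outside the range $0\le p,q\le n$). The map $\partial$ on Dolbeault cohomology is $[\theta]_{\bar\partial}\mapsto[\partial\theta]_{\bar\partial}$. Set $\mathcal G^{p,q}_{\partial}=\ker(\partial:H^{p,q}_A\to H^{p+1,q}_{\bar\partial},\ [\theta]_A\mapsto[\partial\theta]_{\bar\partial})$, $G^{p,q}_{\partial}=\mathcal G^{p,q}_{\partial}/\operatorname{im}(H^{p,q}_{\partial}\to H^{p,q}_A)$ and $L^{p,q}_{\partial}=H^{p,q}_A/\mathcal G^{p,q}_{\partial}$. $\partial L^{p-1,q}_{\partial}$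 denotes the (injective) image of $L^{p-1,q}_{\partial}$ in $H^{p,q}_{\bar\partial}$ under $\partial$. Write $\mathcal H^{p,q}_{\bar\partial}=H^{p,q}_{\bar\partial}/\operatorname{im}(\partial)$ and $\mathcal H^{p,q}_{\partial}=H^{p,q}_{\partial}/\operatorname{im}(\bar\partial)$ for the images of $H^{p,q}_{\bar\partial}$ and $H^{p,q}_{\partial}$ in $H^{p,q}_A$ under the natural maps; inside $H^{p,q}_A$ one has $\mathcal H^{p,q}_{\bar\partial}\cap\mathcal H^{p,q}_{\partial}=K^{p,q}$. By definition $$G^{p,q}_{\partial}\sqcap\left(H^{p,q}_{\bar\partial}/\operatorname{im}(\partial)\right)=\left(\mathcal H^{p,q}_{\bar\partial}\cap\mathcal G^{p,q}_{\partial}\right)/\left(\mathcal H^{p,q}_{\bar\partial}\cap\mathcal H^{p,q}_{\partial}\right).$$ *)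

theory Defs
  imports "HOL-Analysis.Analysis" "HOL-Algebra.AbelCoset" "HOL-Algebra.Module"
begin

section \<open>Smooth functions and compact complex manifolds\<close>

text \<open>In the next two definitions the set \<open>S\<close> is always open. Differentiability is over the reals.\<close>

primrec Ck_on :: "nat \<Rightarrow> 'a::real_normed_vector set \<Rightarrow> ('a \<Rightarrow> 'b::real_normed_vector) \<Rightarrow> bool" where
  "Ck_on 0 S f \<longleftrightarrow> continuous_on S f"
| "Ck_on (Suc k) S f \<longleftrightarrow> (\<forall>x\<in>S. f differentiable (at x)) \<and>
     (\<forall>v. Ck_on k S (\<lambda>x. frechet_derivative f (at x) v))"

definition smooth_on :: "'a::real_normed_vector set \<Rightarrow> ('a \<Rightarrow> 'b::real_normed_vector) \<Rightarrow> bool" where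
  "smooth_on S f \<longleftrightarrow> (\<forall>k. Ck_on k S f)"

text \<open>Holomorphic maps in several variables: smooth maps satisfying the Cauchy--Riemann equations,
  i.e. with complex linear differential.\<close>

definition holomorphic_map_on :: "(complex^'n) set \<Rightarrow> (complex^'n \<Rightarrow> complex^'m) \<Rightarrow> bool" where
  "holomorphic_map_on S f \<longleftrightarrow> smooth_on S f \<and>
     (\<forall>z\<in>S. Vector_Spaces.linear (*s) (*s) (frechet_derivative f (at z)))"

text \<open>A chart is a coordinate domain \<open>U\<close> together with a coordinate map, whose values outside \<open>U\<close>
  are irrelevant.\<close>

type_synonym ('a, 'n) chart = "'a set \<times> ('a \<Rightarrow> complex^'n)"

abbreviation chart_image :: "('a, 'n::finite) chart \<Rightarrow> (complex^'n) set" where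
  "chart_image c \<equiv> snd c ` fst c"

definition is_chart :: "'a topology \<Rightarrow> ('a, 'n::finite) chart \<Rightarrow> bool" where
  "is_chart X c \<longleftrightarrow> openin X (fst c) \<and> open (chart_image c) \<and>
     homeomorphic_map (subtopology X (fst c)) (top_of_set (chart_image c)) (snd c)"

definition overlap :: "('a, 'n::finite) chart \<Rightarrow> ('a, 'n) chart \<Rightarrow> (complex^'n) set" where
  "overlap c d = snd c ` (fst c \<inter> fst d)"

text \<open>The change of coordinates from \<open>c\<close> to \<open>d\<close>, a map \<open>overlap c d \<rightarrow> overlap d c\<close>.\<close>

definition transition :: "('a, 'n::finite) chart \<Rightarrow> ('a, 'n) chart \<Rightarrow> complex^'n \<Rightarrow> complex^'n" where
  "transition c d = snd d \<circ> inv_into (fst c) (snd c)"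

text \<open>The complex dimension is \<open>CARD('n)\<close>.\<close>

definition compact_complex_manifold :: "'a topology \<Rightarrow> ('a, 'n::finite) chart set \<Rightarrow> bool" where
  "compact_complex_manifold X A \<longleftrightarrow>
     compact_space X \<and> Hausdorff_space X \<and> second_countable X \<and>
     (\<forall>c\<in>A. is_chart X c) \<and> (\<Union>c\<in>A. fst c) = topspace X \<and>
     (\<forall>c\<in>A. \<forall>d\<in>A. holomorphic_map_on (overlap c d) (transition c d))"


section \<open>Smooth complex-valued $(p,q)$-forms\<close>

text \<open>A \<open>k\<close>-covector is a function of lists of tangent vectors, vanishing on lists of length other
  than \<open>k\<close>. The wedge product of the 1-covectors \<open>as\<close> is \<open>det (as\<^sub>i (vs\<^sub>j))\<close>.\<close>

definition wedge :: "('v \<Rightarrow> complex) list \<Rightarrow> 'v list \<Rightarrow> complex" where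
  "wedge as vs = (if length vs = length as
     then \<Sum>\<pi> | \<pi> permutes {..<length as}.
            of_int (sign \<pi>) * (\<Prod>i<length as. (as ! i) (vs ! \<pi> i))
     else 0)"

definition dz :: "'n::finite \<Rightarrow> complex^'n \<Rightarrow> complex" where "dz i v = v $ i"

definition dzbar :: "'n::finite \<Rightarrow> complex^'n \<Rightarrow> complex" where "dzbar i v = cnj (v $ i)"

text \<open>Smooth (p,q)-forms \<open>\<Sum> f\<^sub>I\<^sub>J dz\<^sub>I \<and> dzbar\<^sub>J\<close> on an open set. All multi-indices of the right
  length are allowed, not only the increasing ones; this gives the same forms.\<close>

definition local_form ::
  "nat \<Rightarrow> nat \<Rightarrow> (complex^'n::finite) set \<Rightarrow> (complex^'n \<Rightarrow> (complex^'n) list \<Rightarrow> complex) \<Rightarrow> bool" where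
  "local_form p q S \<alpha> \<longleftrightarrow> (\<exists>f. (\<forall>I J. smooth_on S (f I J)) \<and>
     (\<forall>z\<in>S. \<forall>vs. \<alpha> z vs =
        (\<Sum>I | length I = p. \<Sum>J | length J = q. f I J z * wedge (map dz I @ map dzbar J) vs)))"

text \<open>Global forms: a form is the family of its coordinate expressions in the charts of the atlas,
  compatible under pullback along the changes of coordinates. It is extended by 0 to arguments that
  are not charts, and to points outside the image of a chart, so that equality of forms is equality
  of functions.\<close>

type_synonym ('a, 'n) form = "('a, 'n) chart \<Rightarrow> complex^'n \<Rightarrow> (complex^'n) list \<Rightarrow> complex"

definition zero_form :: "('a, 'n::finite) form" where "zero_form = (\<lambda>c z vs. 0)"

definition form_set :: "('a, 'n::finite) chart set \<Rightarrow> nat \<Rightarrow> nat \<Rightarrow> ('a, 'n) form set" where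
  "form_set A p q = {\<omega>.
     (\<forall>c\<in>A. local_form p q (chart_image c) (\<omega> c)) \<and>
     (\<forall>c\<in>A. \<forall>d\<in>A. \<forall>z\<in>overlap c d. \<forall>vs.
        \<omega> c z vs = \<omega> d (transition c d z) (map (frechet_derivative (transition c d) (at z)) vs)) \<and>
     (\<forall>c z vs. c \<notin> A \<or> z \<notin> chart_image c \<longrightarrow> \<omega> c z vs = 0)}"

text \<open>The complex vector space of smooth (p,q)-forms, as a HOL-Algebra module whose scalars are the
  type \<open>complex\<close> (the fields \<open>mult\<close> and \<open>one\<close> play no role). It is zero for negative \<open>p\<close> or \<open>q\<close>;
  for \<open>p\<close> or \<open>q\<close> exceeding the dimension all \<open>dz\<^sub>I \<and> dzbar\<^sub>J\<close> vanish.\<close>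

definition forms :: "('a, 'n::finite) chart set \<Rightarrow> int \<Rightarrow> int \<Rightarrow> (complex, ('a, 'n) form) module" where
  "forms A p q = \<lparr>
     carrier = (if 0 \<le> p \<and> 0 \<le> q then form_set A (nat p) (nat q) else {zero_form}),
     mult = undefined,
     one = undefined,
     zero = zero_form,
     add = (\<lambda>\<omega> \<eta> c z vs. \<omega> c z vs + \<eta> c z vs),
     smult = (\<lambda>a \<omega> c z vs. a * \<omega> c z vs)\<rparr>"


section \<open>The operators \<open>\<partial>\<close> and \<open>\<partial>bar\<close>\<close>

definition deriv_z :: "'n::finite \<Rightarrow> (complex^'n \<Rightarrow> complex) \<Rightarrow> complex^'n \<Rightarrow> complex" where
  "deriv_z j f z =
     (frechet_derivative f (at z) (axis j 1) - \<i> * frechet_derivative f (at z) (axis j \<i>)) / 2"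

definition deriv_zbar :: "'n::finite \<Rightarrow> (complex^'n \<Rightarrow> complex) \<Rightarrow> complex^'n \<Rightarrow> complex" where
  "deriv_zbar j f z =
     (frechet_derivative f (at z) (axis j 1) + \<i> * frechet_derivative f (at z) (axis j \<i>)) / 2"

definition remove_nth :: "nat \<Rightarrow> 'v list \<Rightarrow> 'v list" where
  "remove_nth i vs = take i vs @ drop (Suc i) vs"

text \<open>\<open>\<partial>\<alpha> = \<Sum>\<^sub>j dz\<^sub>j \<and> \<partial>\<alpha>/\<partial>z\<^sub>j\<close> and \<open>\<partial>bar \<alpha> = \<Sum>\<^sub>j dzbar\<^sub>j \<and> \<partial>\<alpha>/\<partial>zbar\<^sub>j\<close>, where
  \<open>(\<beta> \<and> \<gamma>)(v\<^sub>0, \<dots>, v\<^sub>k) = \<Sum>\<^sub>i (-1)\<^sup>i \<beta>(v\<^sub>i) \<gamma>(\<dots>, omit v\<^sub>i, \<dots>)\<close> for a 1-covector \<open>\<beta>\<close>.\<close>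

definition local_del ::
  "(complex^'n::finite \<Rightarrow> (complex^'n) list \<Rightarrow> complex) \<Rightarrow> complex^'n \<Rightarrow> (complex^'n) list \<Rightarrow> complex" where
  "local_del \<alpha> z vs = (\<Sum>i<length vs. \<Sum>j\<in>UNIV.
     (-1) ^ i * dz j (vs ! i) * deriv_z j (\<lambda>w. \<alpha> w (remove_nth i vs)) z)"

definition local_delbar ::
  "(complex^'n::finite \<Rightarrow> (complex^'n) list \<Rightarrow> complex) \<Rightarrow> complex^'n \<Rightarrow> (complex^'n) list \<Rightarrow> complex" where
  "local_delbar \<alpha> z vs = (\<Sum>i<length vs. \<Sum>j\<in>UNIV.
     (-1) ^ i * dzbar j (vs ! i) * deriv_zbar j (\<lambda>w. \<alpha> w (remove_nth i vs)) z)"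

definition del :: "('a, 'n::finite) chart set \<Rightarrow> ('a, 'n) form \<Rightarrow> ('a, 'n) form" where
  "del A \<omega> = (\<lambda>c z vs. if c \<in> A \<and> z \<in> chart_image c then local_del (\<omega> c) z vs else 0)"

definition delbar :: "('a, 'n::finite) chart set \<Rightarrow> ('a, 'n) form \<Rightarrow> ('a, 'n) form" where
  "delbar A \<omega> = (\<lambda>c z vs. if c \<in> A \<and> z \<in> chart_image c then local_delbar (\<omega> c) z vs else 0)"

definition ker_del :: "('a, 'n::finite) chart set \<Rightarrow> int \<Rightarrow> int \<Rightarrow> ('a, 'n) form set" where
  "ker_del A p q = {\<omega> \<in> carrier (forms A p q). del A \<omega> = zero_form}"

definition ker_delbar :: "('a, 'n::finite) chart set \<Rightarrow> int \<Rightarrow> int \<Rightarrow> ('a, 'n) form set" where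
  "ker_delbar A p q = {\<omega> \<in> carrier (forms A p q). delbar A \<omega> = zero_form}"

definition ker_del_delbar :: "('a, 'n::finite) chart set \<Rightarrow> int \<Rightarrow> int \<Rightarrow> ('a, 'n) form set" where
  "ker_del_delbar A p q = {\<omega> \<in> carrier (forms A p q). del A (delbar A \<omega>) = zero_form}"

text \<open>The images in bidegree \<open>(p, q)\<close>.\<close>

definition im_del :: "('a, 'n::finite) chart set \<Rightarrow> int \<Rightarrow> int \<Rightarrow> ('a, 'n) form set" where
  "im_del A p q = del A ` carrier (forms A (p - 1) q)"

definition im_delbar :: "('a, 'n::finite) chart set \<Rightarrow> int \<Rightarrow> int \<Rightarrow> ('a, 'n) form set" where
  "im_delbar A p q = delbar A ` carrier (forms A p (q - 1))"


section \<open>Subspaces, quotients, direct sums and isomorphisms of complex vector spaces\<close>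

definition subspace_of :: "('c, 'b) module \<Rightarrow> 'b set \<Rightarrow> ('c, 'b) module" where
  "subspace_of M V = M\<lparr>carrier := V\<rparr>"

definition quotient_space :: "('c, 'b) module \<Rightarrow> 'b set \<Rightarrow> ('c, 'b set) module" where
  "quotient_space M W = \<lparr>
     carrier = a_rcosets\<^bsub>M\<^esub> W,
     mult = undefined,
     one = undefined,
     zero = W,
     add = (\<lambda>C D. C <+>\<^bsub>M\<^esub> D),
     smult = (\<lambda>a C. \<Union>x\<in>C. W +>\<^bsub>M\<^esub> (a \<odot>\<^bsub>M\<^esub> x))\<rparr>"

text \<open>The map \<open>[x] \<mapsto> [f x]\<close> into the quotient of \<open>N\<close> by \<open>W\<close>.\<close>

definition induced_map :: "('c, 'd) module \<Rightarrow> 'd set \<Rightarrow> ('b \<Rightarrow> 'd) \<Rightarrow> 'b set \<Rightarrow> 'd set" where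
  "induced_map N W f C = (\<Union>x\<in>C. W +>\<^bsub>N\<^esub> f x)"

definition direct_sum :: "('c, 'b) module \<Rightarrow> ('c, 'd) module \<Rightarrow> ('c, 'b \<times> 'd) module"
    (infixr \<open>\<oplus>\<^sub>V\<close> 65) where
  "M \<oplus>\<^sub>V N = \<lparr>
     carrier = carrier M \<times> carrier N,
     mult = undefined,
     one = undefined,
     zero = (\<zero>\<^bsub>M\<^esub>, \<zero>\<^bsub>N\<^esub>),
     add = (\<lambda>(x, y) (x', y'). (x \<oplus>\<^bsub>M\<^esub> x', y \<oplus>\<^bsub>N\<^esub> y')),
     smult = (\<lambda>a (x, y). (a \<odot>\<^bsub>M\<^esub> x, a \<odot>\<^bsub>N\<^esub> y))\<rparr>"

definition linear_iso :: "(complex, 'b) module \<Rightarrow> (complex, 'd) module \<Rightarrow> bool"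
    (infix \<open>\<cong>\<^sub>V\<close> 50) where
  "M \<cong>\<^sub>V N \<longleftrightarrow> (\<exists>f. bij_betw f (carrier M) (carrier N) \<and>
     (\<forall>x\<in>carrier M. \<forall>y\<in>carrier M. f (x \<oplus>\<^bsub>M\<^esub> y) = f x \<oplus>\<^bsub>N\<^esub> f y) \<and>
     (\<forall>a. \<forall>x\<in>carrier M. f (a \<odot>\<^bsub>M\<^esub> x) = a \<odot>\<^bsub>N\<^esub> f x))"


section \<open>Cohomology\<close>

definition aeppli_im :: "('a, 'n::finite) chart set \<Rightarrow> int \<Rightarrow> int \<Rightarrow> ('a, 'n) form set" where
  "aeppli_im A p q = im_del A p q <+>\<^bsub>forms A p q\<^esub> im_delbar A p q"

definition H_A :: "('a, 'n::finite) chart set \<Rightarrow> int \<Rightarrow> int \<Rightarrow> (complex, ('a, 'n) form set) module" where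
  "H_A A p q = quotient_space (subspace_of (forms A p q) (ker_del_delbar A p q)) (aeppli_im A p q)"

definition H_delbar :: "('a, 'n::finite) chart set \<Rightarrow> int \<Rightarrow> int \<Rightarrow> (complex, ('a, 'n) form set) module" where
  "H_delbar A p q = quotient_space (subspace_of (forms A p q) (ker_delbar A p q)) (im_delbar A p q)"

definition H_del :: "('a, 'n::finite) chart set \<Rightarrow> int \<Rightarrow> int \<Rightarrow> (complex, ('a, 'n) form set) module" where
  "H_del A p q = quotient_space (subspace_of (forms A p q) (ker_del A p q)) (im_del A p q)"

definition K :: "('a, 'n::finite) chart set \<Rightarrow> int \<Rightarrow> int \<Rightarrow> (complex, ('a, 'n) form set) module" where
  "K A p q = quotient_space
     (subspace_of (forms A p q) (ker_del A p q \<inter> ker_delbar A p q))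
     ((im_del A p q \<inter> ker_delbar A p q) <+>\<^bsub>forms A p q\<^esub> (im_delbar A p q \<inter> ker_del A p q))"

text \<open>The map \<open>[\<theta>] \<mapsto> [\<partial>\<theta>]\<close> into Dolbeault cohomology of bidegree \<open>(p + 1, q)\<close>, used both on
  Dolbeault and on Aeppli classes of bidegree \<open>(p, q)\<close>.\<close>

definition del_class :: "('a, 'n::finite) chart set \<Rightarrow> int \<Rightarrow> int \<Rightarrow> ('a, 'n) form set \<Rightarrow> ('a, 'n) form set" where
  "del_class A p q = induced_map (forms A (p + 1) q) (im_delbar A (p + 1) q) (del A)"

text \<open>The natural map \<open>[\<theta>] \<mapsto> [\<theta>]\<close> into Aeppli cohomology, used both on Dolbeault classes and on
  their conjugate analogues \<open>H_del\<close>.\<close>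

definition to_H_A :: "('a, 'n::finite) chart set \<Rightarrow> int \<Rightarrow> int \<Rightarrow> ('a, 'n) form set \<Rightarrow> ('a, 'n) form set" where
  "to_H_A A p q = induced_map (forms A p q) (aeppli_im A p q) id"

definition ker_del_H_delbar ::
    "('a, 'n::finite) chart set \<Rightarrow> int \<Rightarrow> int \<Rightarrow> (complex, ('a, 'n) form set) module" where
  "ker_del_H_delbar A p q = subspace_of (H_delbar A p q)
     {C \<in> carrier (H_delbar A p q). del_class A p q C = \<zero>\<^bsub>H_delbar A (p + 1) q\<^esub>}"

definition calG_del :: "('a, 'n::finite) chart set \<Rightarrow> int \<Rightarrow> int \<Rightarrow> ('a, 'n) form set set" where
  "calG_del A p q = {C \<in> carrier (H_A A p q). del_class A p q C = \<zero>\<^bsub>H_delbar A (p + 1) q\<^esub>}"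

definition L_del :: "('a, 'n::finite) chart set \<Rightarrow> int \<Rightarrow> int \<Rightarrow> (complex, ('a, 'n) form set set) module" where
  "L_del A p q = quotient_space (H_A A p q) (calG_del A p q)"

text \<open>The image of \<open>L_del A p q\<close> in Dolbeault cohomology of bidegree \<open>(p + 1, q)\<close>. An element \<open>D\<close> of
  \<open>L_del A p q\<close> is a coset of Aeppli classes, on which \<open>del_class\<close> is constant.\<close>

definition del_L :: "('a, 'n::finite) chart set \<Rightarrow> int \<Rightarrow> int \<Rightarrow> (complex, ('a, 'n) form set) module" where
  "del_L A p q = subspace_of (H_delbar A (p + 1) q)
     ((\<lambda>D. \<Union>C\<in>D. del_class A p q C) ` carrier (L_del A p q))"

definition calH_delbar :: "('a, 'n::finite) chart set \<Rightarrow> int \<Rightarrow> int \<Rightarrow> ('a, 'n) form set set" where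
  "calH_delbar A p q = to_H_A A p q ` carrier (H_delbar A p q)"

definition calH_del :: "('a, 'n::finite) chart set \<Rightarrow> int \<Rightarrow> int \<Rightarrow> ('a, 'n) form set set" where
  "calH_del A p q = to_H_A A p q ` carrier (H_del A p q)"

text \<open>The space \<open>G\<^sub>\<partial> \<sqinter> (H\<^sub>\<partial>\<^sub>b\<^sub>a\<^sub>r / im \<partial>)\<close>, by definition this quotient of subspaces of \<open>H_A\<close>.\<close>

definition G_meet :: "('a, 'n::finite) chart set \<Rightarrow> int \<Rightarrow> int \<Rightarrow> (complex, ('a, 'n) form set set) module" where
  "G_meet A p q = quotient_space
     (subspace_of (H_A A p q) (calH_delbar A p q \<inter> calG_del A p q))
     (calH_delbar A p q \<inter> calH_del A p q)"

end

theory Submission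
  imports Defs "HOL-Library.Function_Algebras" "Jordan_Normal_Form.Determinant"
begin

text \<open>All spaces in the statement are quotients of subspaces of the space of \<open>(p, q)\<close>-forms. For
  \<open>W = im \<partial>bar\<close> there is a chain of subspaces
  \<open>W \<subseteq> (im \<partial> \<inter> ker \<partial>bar) + W \<subseteq> (ker \<partial> \<inter> ker \<partial>bar) + W \<subseteq> {x \<in> ker \<partial>bar. \<partial>x \<in> im \<partial>bar}\<close>
  whose successive quotients are \<open>\<partial>L\<close>, \<open>K\<close> (by the second isomorphism theorem) and \<open>G \<sqinter> (H / im \<partial>)\<close>,
  and whose total quotient is the kernel of \<open>\<partial>\<close> on Dolbeault cohomology; since complements
  of subspaces exist, the total quotient is the direct sum of the successive ones. This uses that
  \<open>\<partial>\<close> and \<open>\<partial>bar\<close> map global forms to global forms and that \<open>\<partial>\<^sup>2 = \<partial>bar\<^sup>2 = \<partial>\<partial>bar + \<partial>bar\<partial> = 0\<close>, which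
  rest on the symmetry of second derivatives.\<close>

section \<open>Presentations of quotient spaces\<close>

text \<open>\<open>presents s U W \<pi> M\<close>: the map \<open>\<pi>\<close> induces an isomorphism \<open>U / W \<cong> M\<close>. This avoids handling iterated
  cosets.\<close>

definition presents ::
    "('c \<Rightarrow> 'v \<Rightarrow> 'v) \<Rightarrow> 'v::ab_group_add set \<Rightarrow> 'v set \<Rightarrow> ('v \<Rightarrow> 'm) \<Rightarrow> ('c, 'm) module \<Rightarrow> bool" where
  "presents s U W \<pi> M \<longleftrightarrow> \<pi> ` U = carrier M \<and>
     (\<forall>x\<in>U. \<forall>y\<in>U. \<pi> (x + y) = \<pi> x \<oplus>\<^bsub>M\<^esub> \<pi> y) \<and>
     (\<forall>a. \<forall>x\<in>U. \<pi> (s a x) = a \<odot>\<^bsub>M\<^esub> \<pi> x) \<and>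
     (\<forall>x\<in>U. \<forall>y\<in>U. \<pi> x = \<pi> y \<longleftrightarrow> x - y \<in> W)"

lemma presentsD:
  assumes "presents s U W \<pi> M"
  shows "\<pi> ` U = carrier M"
    and "\<And>x y. x \<in> U \<Longrightarrow> y \<in> U \<Longrightarrow> \<pi> (x + y) = \<pi> x \<oplus>\<^bsub>M\<^esub> \<pi> y"
    and "\<And>a x. x \<in> U \<Longrightarrow> \<pi> (s a x) = a \<odot>\<^bsub>M\<^esub> \<pi> x"
    and "\<And>x y. x \<in> U \<Longrightarrow> y \<in> U \<Longrightarrow> \<pi> x = \<pi> y \<longleftrightarrow> x - y \<in> W"
  using assms unfolding presents_def by blast+

lemma presents_subspace_of:
  assumes "presents s U W \<pi> M" "U' \<subseteq> U"
  shows "presents s U' W \<pi> (subspace_of M (\<pi> ` U'))"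
  using assms unfolding presents_def subspace_of_def by (simp add: subset_iff)

lemma a_r_coset_eq: "W +>\<^bsub>M\<^esub> x = (\<lambda>w. w \<oplus>\<^bsub>M\<^esub> x) ` W"
  by (auto simp: a_r_coset_def')

context vector_space
begin

lemma presents_iso:
  assumes U: "subspace U" and M: "presents scale U W \<pi> M" and N: "presents scale U W \<rho> N"
  shows "\<exists>f. bij_betw f (carrier M) (carrier N) \<and>
     (\<forall>x\<in>carrier M. \<forall>y\<in>carrier M. f (x \<oplus>\<^bsub>M\<^esub> y) = f x \<oplus>\<^bsub>N\<^esub> f y) \<and>
     (\<forall>a. \<forall>x\<in>carrier M. f (a \<odot>\<^bsub>M\<^esub> x) = a \<odot>\<^bsub>N\<^esub> f x)"
proof -
  note M' = presentsD[OF M] and N' = presentsD[OF N]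
  define f where "f = \<rho> \<circ> inv_into U \<pi>"
  have f: "f (\<pi> x) = \<rho> x" if "x \<in> U" for x
  proof -
    have "inv_into U \<pi> (\<pi> x) \<in> U" "\<pi> (inv_into U \<pi> (\<pi> x)) = \<pi> x"
      using that by (simp_all add: inv_into_into f_inv_into_f)
    then show ?thesis using M'(4) N'(4) that by (simp add: f_def)
  qed
  have "inj_on f (carrier M)"
    unfolding M'(1)[symmetric] by (rule inj_onI) (use f M'(4) N'(4) in auto)
  moreover have "f ` carrier M = carrier N"
    unfolding M'(1)[symmetric] N'(1)[symmetric] image_image using f by simp
  moreover have "f (x \<oplus>\<^bsub>M\<^esub> y) = f x \<oplus>\<^bsub>N\<^esub> f y" if "x \<in> carrier M" "y \<in> carrier M" for x y
    using that unfolding M'(1)[symmetric]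
    by (auto simp: f N'(2) subspace_add[OF U] simp flip: M'(2))
  moreover have "f (a \<odot>\<^bsub>M\<^esub> x) = a \<odot>\<^bsub>N\<^esub> f x" if "x \<in> carrier M" for a x
    using that unfolding M'(1)[symmetric]
    by (auto simp: f N'(3) subspace_scale[OF U] simp flip: M'(3))
  ultimately show ?thesis by (auto simp: bij_betw_def)
qed

lemma presents_direct_sum:
  assumes U: "subspace U" and T: "subspace T" "T \<subseteq> U" and W: "W \<subseteq> T"
    and M: "presents scale U T \<pi> M" and N: "presents scale T W \<rho> N"
  shows "\<exists>\<sigma>. presents scale U W \<sigma> (M \<oplus>\<^sub>V N)"
proof -
  note M' = presentsD[OF M] and N' = presentsD[OF N]
  interpret vector_space_pair scale scale ..
  have "\<exists>r. r ` UNIV \<subseteq> T \<and> Vector_Spaces.linear scale scale r \<and> (\<forall>v\<in>T. r (id v) = v)"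
    using linear_exists_left_inverse_on[OF linear_id T(1) inj_on_id] by simp
  then obtain r where r: "\<And>x. r x \<in> T" "Vector_Spaces.linear scale scale r" "\<And>x. x \<in> T \<Longrightarrow> r x = x"
    by auto
  interpret r: Vector_Spaces.linear scale scale r by (fact r(2))
  let ?\<sigma> = "\<lambda>x. (\<pi> x, \<rho> (r x))"
  have "?\<sigma> ` U = carrier M \<times> carrier N"
  proof (intro equalityI subsetI)
    fix c assume "c \<in> carrier M \<times> carrier N"
    then obtain y t where yt: "y \<in> U" "t \<in> T" "c = (\<pi> y, \<rho> t)"
      unfolding M'(1)[symmetric] N'(1)[symmetric] by auto
    let ?x = "y + (t - r y)"
    have x: "?x \<in> U" using yt(1,2) r(1)[of y] T U by (auto intro!: subspace_add subspace_diff)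
    moreover have "\<pi> ?x = \<pi> y"
      using M'(4)[OF x yt(1)] yt(2) r(1)[of y] T(1) by (auto intro: subspace_diff)
    moreover have "r ?x = t" using yt(2) r by (simp add: r.add r.diff)
    ultimately show "c \<in> ?\<sigma> ` U" using yt(3) by (auto intro!: image_eqI[of _ _ ?x])
  qed (use r M'(1) N'(1) in auto)
  moreover have "?\<sigma> x = ?\<sigma> y \<longleftrightarrow> x - y \<in> W" if "x \<in> U" "y \<in> U" for x y
  proof -
    have "?\<sigma> x = ?\<sigma> y \<longleftrightarrow> x - y \<in> T \<and> r (x - y) \<in> W"
      using M'(4) N'(4) r(1) that by (simp add: r.diff)
    then show ?thesis using W r(3) by auto
  qed
  ultimately have "presents scale U W ?\<sigma> (M \<oplus>\<^sub>V N)"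
    using M'(2,3) N'(2,3) r(1) by (auto simp: presents_def direct_sum_def r.add r.scale)
  then show ?thesis by blast
qed

lemma presents_second_iso:
  assumes C: "subspace C" and T: "subspace T" and M: "presents scale C (C \<inter> T) \<pi> M"
  shows "\<exists>\<rho>. presents scale {c + t | c t. c \<in> C \<and> t \<in> T} T \<rho> M"
proof -
  note M' = presentsD[OF M]
  let ?U = "{c + t | c t. c \<in> C \<and> t \<in> T}"
  define g where "g x = (SOME c. c \<in> C \<and> x - c \<in> T)" for x
  have g: "g x \<in> C" "x - g x \<in> T" if "x \<in> ?U" for x
  proof -
    have "\<exists>c. c \<in> C \<and> x - c \<in> T" using that by auto
    then show "g x \<in> C" "x - g x \<in> T" unfolding g_def by (smt (verit, ccfv_SIG) someI_ex)+
  qed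
  have eq: "\<pi> (g x) = \<pi> c" if "x \<in> ?U" "c \<in> C" "x - c \<in> T" for x c
  proof -
    have "g x - c = (x - c) - (x - g x)" by simp
    then have "g x - c \<in> C \<inter> T"
      using g[OF that(1)] that subspace_diff[OF C] subspace_diff[OF T] by (metis IntI)
    then show ?thesis using M'(4) g(1)[OF that(1)] that(2) by simp
  qed
  have add: "x + y \<in> ?U" if "x \<in> ?U" "y \<in> ?U" for x y
    using subspace_sums[OF C T] that by (rule subspace_add)
  have scale: "scale a x \<in> ?U" if "x \<in> ?U" for a x
    using subspace_sums[OF C T] that by (rule subspace_scale)
  have "(\<lambda>x. \<pi> (g x)) ` ?U = carrier M"
  proof (intro equalityI subsetI)
    fix m assume "m \<in> carrier M"
    then obtain c where c: "c \<in> C" "m = \<pi> c" using M'(1) by auto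
    then have "c \<in> ?U" using subspace_0[OF T] by force
    moreover have "\<pi> (g c) = m" using eq[of c c] c \<open>c \<in> ?U\<close> subspace_0[OF T] by simp
    ultimately show "m \<in> (\<lambda>x. \<pi> (g x)) ` ?U" by blast
  qed (use M'(1) g(1) in blast)
  moreover have "\<pi> (g (x + y)) = \<pi> (g x) \<oplus>\<^bsub>M\<^esub> \<pi> (g y)" if x: "x \<in> ?U" and y: "y \<in> ?U" for x y
  proof -
    have "x + y - (g x + g y) = (x - g x) + (y - g y)" by simp
    then have "\<pi> (g (x + y)) = \<pi> (g x + g y)"
      using eq[OF add[OF x y]] g[OF x] g[OF y] subspace_add[OF C] subspace_add[OF T] by metis
    then show ?thesis using M'(2) g(1) x y by simp
  qed
  moreover have "\<pi> (g (scale a x)) = a \<odot>\<^bsub>M\<^esub> \<pi> (g x)" if x: "x \<in> ?U" for a x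
  proof -
    have "scale a x - scale a (g x) = scale a (x - g x)" by (simp add: scale_right_diff_distrib)
    then have "\<pi> (g (scale a x)) = \<pi> (scale a (g x))"
      using eq[OF scale[OF x]] g[OF x] subspace_scale[OF C] subspace_scale[OF T] by metis
    then show ?thesis using M'(3) g(1) x by simp
  qed
  moreover have "\<pi> (g x) = \<pi> (g y) \<longleftrightarrow> x - y \<in> T" if x: "x \<in> ?U" and y: "y \<in> ?U" for x y
  proof
    assume "\<pi> (g x) = \<pi> (g y)"
    then have "g x - g y \<in> T" using M'(4) g(1) x y by simp
    moreover have "x - y = (x - g x) + (g x - g y) - (y - g y)" by simp
    ultimately show "x - y \<in> T"
      using g(2)[OF x] g(2)[OF y] subspace_add[OF T] subspace_diff[OF T] by metis
  next
    assume "x - y \<in> T"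
    moreover have "x - g y = (x - y) + (y - g y)" by simp
    ultimately have "x - g y \<in> T" using g(2)[OF y] subspace_add[OF T] by metis
    then show "\<pi> (g x) = \<pi> (g y)" using eq x g(1)[OF y] by simp
  qed
  ultimately show ?thesis by (intro exI[of _ "\<lambda>x. \<pi> (g x)"]) (simp only: presents_def, blast)
qed

lemma presents_quotient_space:
  assumes U: "subspace U" and T: "subspace T" "T \<subseteq> U" and U': "subspace U'" "U' \<subseteq> U"
    and M: "presents scale U W \<pi> M"
  shows "presents scale U' {x \<in> U'. \<exists>t\<in>T. x - t \<in> W} (\<lambda>x. \<pi> ` T +>\<^bsub>M\<^esub> \<pi> x)
           (quotient_space (subspace_of M (\<pi> ` U')) (\<pi> ` T))"
proof -
  note M' = presentsD[OF M]
  let ?Q = "quotient_space (subspace_of M (\<pi> ` U')) (\<pi> ` T)"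
  let ?\<rho> = "\<lambda>x. \<pi> ` T +>\<^bsub>M\<^esub> \<pi> x"
  have \<rho>: "?\<rho> x = (\<lambda>t. \<pi> (t + x)) ` T" if "x \<in> U" for x
    using that T M'(2) by (auto simp: a_r_coset_eq image_image subset_iff intro!: image_cong)
  have \<rho>_eq: "?\<rho> x = ?\<rho> y" if "t \<in> T" "x \<in> U" "y \<in> U" "\<pi> x = \<pi> (t + y)" for x y t
  proof -
    have shift: "\<pi> (s + x) = \<pi> ((s + t) + y)" if "s \<in> T" for s
      using that \<open>t \<in> T\<close> \<open>x \<in> U\<close> \<open>y \<in> U\<close> \<open>\<pi> x = \<pi> (t + y)\<close> T
      by (simp add: subset_iff M'(2) subspace_add[OF U] add.assoc)
    have "(\<lambda>s. \<pi> (s + x)) ` T = (\<lambda>s. \<pi> (s + y)) ` (\<lambda>s. s + t) ` T"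
      unfolding image_image using shift by simp
    also have "(\<lambda>s. s + t) ` T = T"
      using that(1) T(1) by (auto simp: image_iff subspace_add intro!: bexI[of _ "_ - t"] subspace_diff)
    finally show ?thesis unfolding \<rho>[OF that(2)] \<rho>[OF that(3)] .
  qed
  have "?\<rho> ` U' = carrier ?Q"
    by (auto simp: quotient_space_def subspace_of_def A_RCOSETS_def' a_r_coset_eq)
  moreover have "?\<rho> (x + y) = ?\<rho> x \<oplus>\<^bsub>?Q\<^esub> ?\<rho> y" if "x \<in> U'" "y \<in> U'" for x y
  proof -
    have xy: "x \<in> U" "y \<in> U" "x + y \<in> U" using that U' U by (auto intro: subspace_add)
    have add: "\<pi> (s + x) \<oplus>\<^bsub>M\<^esub> \<pi> (t + y) = \<pi> (s + t + (x + y))" if "s \<in> T" "t \<in> T" for s t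
      using that xy T U M'(2)[of "s + x" "t + y"] by (simp add: subset_iff subspace_add ac_simps)
    have "?\<rho> x \<oplus>\<^bsub>?Q\<^esub> ?\<rho> y = (\<Union>s\<in>T. \<Union>t\<in>T. {\<pi> (s + t + (x + y))})"
      using add by (simp add: quotient_space_def subspace_of_def set_add_def' \<rho> xy)
    also have "\<dots> = (\<lambda>s. \<pi> (s + (x + y))) ` T"
    proof (intro equalityI subsetI)
      fix m assume "m \<in> (\<lambda>s. \<pi> (s + (x + y))) ` T"
      then obtain s where "s \<in> T" "m = \<pi> (s + 0 + (x + y))" by auto
      then show "m \<in> (\<Union>s\<in>T. \<Union>t\<in>T. {\<pi> (s + t + (x + y))})"
        using subspace_0[OF T(1)] by blast
    qed (use subspace_add[OF T(1)] in blast)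
    finally show ?thesis using \<rho> xy by simp
  qed
  moreover have "?\<rho> (scale a x) = a \<odot>\<^bsub>?Q\<^esub> ?\<rho> x" if "x \<in> U'" for a x
  proof -
    have x: "x \<in> U" "scale a x \<in> U" using that U' U by (auto intro: subspace_scale)
    have "?\<rho> (scale a (t + x)) = ?\<rho> (scale a x)" if "t \<in> T" for t
      using that x T U
      by (intro \<rho>_eq[of "scale a t"]) (auto intro!: subspace_scale subspace_add simp: scale_right_distrib)
    moreover have "a \<odot>\<^bsub>M\<^esub> \<pi> (t + x) = \<pi> (scale a (t + x))" if "t \<in> T" for t
      using that T x U M'(3)[of "t + x" a] by (auto simp: subset_iff subspace_add)
    moreover have "a \<odot>\<^bsub>?Q\<^esub> C = (\<Union>c\<in>C. \<pi> ` T +>\<^bsub>M\<^esub> (a \<odot>\<^bsub>M\<^esub> c))" for C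
      by (simp add: quotient_space_def subspace_of_def a_r_coset_def')
    ultimately have "a \<odot>\<^bsub>?Q\<^esub> ?\<rho> x = (\<Union>t\<in>T. ?\<rho> (scale a x))"
      unfolding \<rho>[OF x(1)] by simp
    then show ?thesis using subspace_0[OF T(1)] by auto
  qed
  moreover have "?\<rho> x = ?\<rho> y \<longleftrightarrow> x - y \<in> {x \<in> U'. \<exists>t\<in>T. x - t \<in> W}" if "x \<in> U'" "y \<in> U'" for x y
  proof -
    have xy: "x \<in> U" "y \<in> U" using that U' by auto
    have "\<pi> x = \<pi> (t + y) \<longleftrightarrow> (x - y) - t \<in> W" if "t \<in> T" for t
      using M'(4)[of x "t + y"] xy that T U by (simp add: subset_iff subspace_add algebra_simps)
    moreover have "?\<rho> x = ?\<rho> y \<longleftrightarrow> (\<exists>t\<in>T. \<pi> x = \<pi> (t + y))"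
    proof
      assume "?\<rho> x = ?\<rho> y"
      moreover have "\<pi> x \<in> ?\<rho> x" using \<rho>[OF xy(1)] subspace_0[OF T(1)] by force
      ultimately show "\<exists>t\<in>T. \<pi> x = \<pi> (t + y)" using \<rho>[OF xy(2)] by auto
    qed (use \<rho>_eq xy in blast)
    ultimately show ?thesis using subspace_diff[OF U'(1) that] by auto
  qed
  ultimately show ?thesis by (simp add: presents_def)
qed

end

section \<open>Calculus of smooth maps\<close>

abbreviation fd :: "('a::real_normed_vector \<Rightarrow> 'b::real_normed_vector) \<Rightarrow> 'a \<Rightarrow> 'a \<Rightarrow> 'b" where
  "fd f x \<equiv> frechet_derivative f (at x)"

lemma fd_eqI: "(f has_derivative f') (at x) \<Longrightarrow> fd f x = f'"
  by (rule frechet_derivative_at[symmetric])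

lemma has_derivative_fd: "f differentiable (at x) \<Longrightarrow> (f has_derivative fd f x) (at x)"
  by (simp add: frechet_derivative_works)

lemma has_derivative_cong_open:
  assumes "open S" "x \<in> S" "\<And>y. y \<in> S \<Longrightarrow> f y = g y"
  shows "(f has_derivative f') (at x) \<longleftrightarrow> (g has_derivative f') (at x)"
proof
  show "(g has_derivative f') (at x)" if "(f has_derivative f') (at x)"
    using that assms(1,2) by (rule has_derivative_transform_within_open) (rule assms(3))
  show "(f has_derivative f') (at x)" if "(g has_derivative f') (at x)"
    using that assms(1,2) by (rule has_derivative_transform_within_open) (rule assms(3)[symmetric])
qed

lemma fd_cong_open:
  assumes "open S" "x \<in> S" "\<And>y. y \<in> S \<Longrightarrow> f y = g y"
  shows "fd f x = fd g x"
  unfolding frechet_derivative_def by (subst has_derivative_cong_open[OF assms]) auto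

lemma differentiable_cong_open:
  assumes "open S" "x \<in> S" "\<And>y. y \<in> S \<Longrightarrow> f y = g y"
  shows "f differentiable (at x) \<longleftrightarrow> g differentiable (at x)"
  unfolding differentiable_def by (subst has_derivative_cong_open[OF assms]) auto

lemma Ck_on_cong:
  assumes "open S" "\<And>x. x \<in> S \<Longrightarrow> f x = g x"
  shows "Ck_on k S f \<longleftrightarrow> Ck_on k S g"
  using assms(2)
proof (induction k arbitrary: f g)
  case 0
  then show ?case by (auto intro: continuous_on_cong)
next
  case (Suc k)
  have "Ck_on k S (\<lambda>x. fd f x v) \<longleftrightarrow> Ck_on k S (\<lambda>x. fd g x v)" for v
    using fd_cong_open[OF assms(1) _ Suc.prems] by (intro Suc.IH) simp
  then show ?case
    using differentiable_cong_open[OF assms(1) _ Suc.prems] by simp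
qed

lemma Ck_on_add:
  assumes "open S" "Ck_on k S f" "Ck_on k S g"
  shows "Ck_on k S (\<lambda>x. f x + g x)"
  using assms(2,3)
proof (induction k arbitrary: f g)
  case (Suc k)
  have "fd (\<lambda>x. f x + g x) x v = fd f x v + fd g x v" if "x \<in> S" for x v
    using Suc.prems that by (simp add: fd_eqI[OF has_derivative_add[OF has_derivative_fd has_derivative_fd]])
  then have "Ck_on k S (\<lambda>x. fd (\<lambda>x. f x + g x) x v) \<longleftrightarrow> Ck_on k S (\<lambda>x. fd f x v + fd g x v)" for v
    by (intro Ck_on_cong[OF assms(1)]) simp
  then show ?case
    using Suc by simp
qed (simp add: continuous_on_add)

lemma Ck_on_bounded_linear:
  assumes "bounded_linear h" "open S" "Ck_on k S f"
  shows "Ck_on k S (\<lambda>x. h (f x))"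
  using assms(3)
proof (induction k arbitrary: f)
  case 0
  then show ?case by (auto intro: bounded_linear.continuous_on[OF assms(1)])
next
  case (Suc k)
  have d: "((\<lambda>x. h (f x)) has_derivative (\<lambda>v. h (fd f x v))) (at x)" if "x \<in> S" for x
    using Suc.prems that by (intro bounded_linear.has_derivative[OF assms(1)] has_derivative_fd) simp
  have "Ck_on k S (\<lambda>x. fd (\<lambda>x. h (f x)) x v) \<longleftrightarrow> Ck_on k S (\<lambda>x. h (fd f x v))" for v
    by (intro Ck_on_cong[OF assms(2)]) (simp add: fd_eqI[OF d])
  moreover have "Ck_on k S (\<lambda>x. h (fd f x v))" for v
    using Suc by simp
  ultimately show ?case
    using d by (auto simp: differentiable_def)
qed

lemma smooth_on_add:
  "open S \<Longrightarrow> smooth_on S f \<Longrightarrow> smooth_on S g \<Longrightarrow> smooth_on S (\<lambda>x. f x + g x)"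
  by (simp add: smooth_on_def Ck_on_add)

lemma smooth_on_bounded_linear:
  "bounded_linear h \<Longrightarrow> open S \<Longrightarrow> smooth_on S f \<Longrightarrow> smooth_on S (\<lambda>x. h (f x))"
  by (simp add: smooth_on_def Ck_on_bounded_linear)

lemma smooth_on_cong:
  "open S \<Longrightarrow> (\<And>x. x \<in> S \<Longrightarrow> f x = g x) \<Longrightarrow> smooth_on S f \<longleftrightarrow> smooth_on S g"
  unfolding smooth_on_def by (intro all_cong1 Ck_on_cong)

lemma smooth_on_zero: "smooth_on S (\<lambda>_. 0)"
  unfolding smooth_on_def
proof
  show "Ck_on k S (\<lambda>_. 0)" for k by (induction k) auto
qed

lemma smooth_on_sum:
  "open S \<Longrightarrow> (\<And>i. i \<in> I \<Longrightarrow> smooth_on S (f i)) \<Longrightarrow> smooth_on S (\<lambda>x. \<Sum>i\<in>I. f i x)"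
  by (induction I rule: infinite_finite_induct) (auto simp: smooth_on_zero smooth_on_add)

lemma smooth_on_cmult:
  fixes f :: "'a::real_normed_vector \<Rightarrow> 'b::real_normed_algebra"
  shows "open S \<Longrightarrow> smooth_on S f \<Longrightarrow> smooth_on S (\<lambda>x. c * f x)"
  by (rule smooth_on_bounded_linear[OF bounded_linear_mult_right])

lemma smooth_on_Suc: "smooth_on S f \<Longrightarrow> Ck_on (Suc k) S f"
  unfolding smooth_on_def by (rule spec)

lemma smooth_on_fd: "smooth_on S f \<Longrightarrow> smooth_on S (\<lambda>x. fd f x v)"
  unfolding smooth_on_def[of S "\<lambda>x. fd f x v"]
proof
  fix k assume "smooth_on S f"
  then show "Ck_on k S (\<lambda>x. fd f x v)" using smooth_on_Suc[of S f k] by simp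
qed

lemma smooth_on_differentiable: "smooth_on S f \<Longrightarrow> x \<in> S \<Longrightarrow> f differentiable (at x)"
  using smooth_on_Suc[of S f 0] by simp

lemma smooth_on_continuous: "smooth_on S f \<Longrightarrow> continuous_on S f"
  unfolding smooth_on_def by (drule spec[of _ 0]) simp

lemma has_derivative_smooth: "smooth_on S f \<Longrightarrow> x \<in> S \<Longrightarrow> (f has_derivative fd f x) (at x)"
  by (intro has_derivative_fd smooth_on_differentiable)

lemma linear_fd: "f differentiable (at x) \<Longrightarrow> linear (fd f x)"
  by (rule linear_frechet_derivative)

lemma DERIV_along_line:
  fixes f :: "'a::real_normed_vector \<Rightarrow> real"
  assumes "f differentiable (at (a + t *\<^sub>R v))"
  shows "((\<lambda>t. f (a + t *\<^sub>R v)) has_real_derivative fd f (a + t *\<^sub>R v) v) (at t)"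
proof -
  have "((\<lambda>t. a + t *\<^sub>R v) has_derivative (\<lambda>h. h *\<^sub>R v)) (at t)"
    by (auto intro!: derivative_eq_intros)
  then have "((\<lambda>t. f (a + t *\<^sub>R v)) has_derivative (\<lambda>h. fd f (a + t *\<^sub>R v) (h *\<^sub>R v))) (at t)"
    using has_derivative_fd[OF assms] by (rule has_derivative_compose)
  then show ?thesis
    using linear_fd[OF assms] by (simp add: has_field_derivative_def linear_cmul mult_commute_abs)
qed

lemma second_difference_mean_value:
  fixes f :: "'a::real_normed_vector \<Rightarrow> real"
  assumes f: "smooth_on S f" and s: "s > 0"
    and S: "\<And>a b. 0 \<le> a \<Longrightarrow> a \<le> s \<Longrightarrow> 0 \<le> b \<Longrightarrow> b \<le> s \<Longrightarrow> z + a *\<^sub>R u + b *\<^sub>R v \<in> S"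
  shows "\<exists>a b. 0 \<le> a \<and> a \<le> s \<and> 0 \<le> b \<and> b \<le> s \<and>
    f (z + s *\<^sub>R u + s *\<^sub>R v) - f (z + s *\<^sub>R u) - f (z + s *\<^sub>R v) + f z =
      s * s * fd (\<lambda>x. fd f x v) (z + a *\<^sub>R u + b *\<^sub>R v) u"
proof -
  have diff: "f differentiable at (z + a *\<^sub>R u + b *\<^sub>R v)"
    and diff': "(\<lambda>x. fd f x v) differentiable at (z + a *\<^sub>R u + b *\<^sub>R v)"
    if "0 \<le> a" "a \<le> s" "0 \<le> b" "b \<le> s" for a b
    using smooth_on_differentiable[OF f S] smooth_on_differentiable[OF smooth_on_fd[OF f] S] that by blast+
  have "\<exists>b>0. b < s \<and> (f (z + s *\<^sub>R u + s *\<^sub>R v) - f (z + s *\<^sub>R v)) - (f (z + s *\<^sub>R u + 0 *\<^sub>R v) - f (z + 0 *\<^sub>R v)) =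
      (s - 0) * (fd f (z + s *\<^sub>R u + b *\<^sub>R v) v - fd f (z + b *\<^sub>R v) v)"
    using diff[of s] diff[of 0] s
    by (intro MVT2) (auto intro!: DERIV_diff DERIV_along_line)
  then obtain b where b: "0 < b" "b < s" and
    eq1: "f (z + s *\<^sub>R u + s *\<^sub>R v) - f (z + s *\<^sub>R u) - f (z + s *\<^sub>R v) + f z =
      s * (fd f (z + s *\<^sub>R u + b *\<^sub>R v) v - fd f (z + b *\<^sub>R v) v)"
    by (auto simp: algebra_simps)
  have diff'': "(\<lambda>x. fd f x v) differentiable at (z + b *\<^sub>R v + a *\<^sub>R u)" if "0 \<le> a" "a \<le> s" for a
    using diff'[OF that, of b] b by (simp add: ac_simps)
  have "\<exists>a>0. a < s \<and> fd f ((z + b *\<^sub>R v) + s *\<^sub>R u) v - fd f ((z + b *\<^sub>R v) + 0 *\<^sub>R u) v =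
      (s - 0) * fd (\<lambda>x. fd f x v) ((z + b *\<^sub>R v) + a *\<^sub>R u) u"
    using diff'' s by (intro MVT2) (auto intro!: DERIV_along_line)
  then obtain a where a: "0 < a" "a < s" and
    eq2: "fd f (z + s *\<^sub>R u + b *\<^sub>R v) v - fd f (z + b *\<^sub>R v) v =
      s * fd (\<lambda>x. fd f x v) (z + a *\<^sub>R u + b *\<^sub>R v) u"
    by (auto simp: ac_simps)
  show ?thesis
    using a b by (intro exI[of _ a] exI[of _ b] conjI less_imp_le) (auto simp: eq1 eq2 mult.assoc)
qed

lemma fd_fd_commute_real:
  fixes f :: "'a::real_normed_vector \<Rightarrow> real"
  assumes f: "smooth_on S f" and S: "open S" "z \<in> S"
  shows "fd (\<lambda>x. fd f x v) z u = fd (\<lambda>x. fd f x u) z v"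
proof -
  let ?H = "\<lambda>u v w. fd (\<lambda>x. fd f x v) w u"
  have cont: "continuous_on S (?H u v)" for u v
    by (intro smooth_on_continuous smooth_on_fd f)
  have le: "\<bar>?H u v z - ?H v u z\<bar> \<le> e" if "e > 0" for e
  proof -
    have ev: "\<forall>\<^sub>F w in nhds z. \<bar>?H u v w - ?H u v z\<bar> < e / 2" for u v
    proof -
      have "(?H u v \<longlongrightarrow> ?H u v z) (nhds z)"
        using cont S by (simp add: continuous_on_eq_continuous_at isCont_def tendsto_nhds_iff)
      then show ?thesis
        using that by (auto dest!: tendstoD[of _ _ _ "e / 2"] simp: dist_real_def)
    qed
    have "\<forall>\<^sub>F w in nhds z. w \<in> S \<and> \<bar>?H u v w - ?H u v z\<bar> < e / 2 \<and> \<bar>?H v u w - ?H v u z\<bar> < e / 2"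
      using ev[of u v] ev[of v u] eventually_nhds_in_open[OF S] by eventually_elim simp
    then obtain d where d: "d > 0" and close: "\<And>w. dist w z < d \<Longrightarrow>
        w \<in> S \<and> \<bar>?H u v w - ?H u v z\<bar> < e / 2 \<and> \<bar>?H v u w - ?H v u z\<bar> < e / 2"
      unfolding eventually_nhds_metric by blast
    define s where "s = d / (norm u + norm v + 1)"
    have pos: "norm u + norm v + 1 > 0" by (smt (verit) norm_ge_zero)
    have s: "s > 0" using d pos by (simp add: s_def)
    have near: "dist (z + a *\<^sub>R u + b *\<^sub>R v) z < d" if "0 \<le> a" "a \<le> s" "0 \<le> b" "b \<le> s" for a b
    proof -
      have "dist (z + a *\<^sub>R u + b *\<^sub>R v) z = norm (a *\<^sub>R u + b *\<^sub>R v)"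
        by (simp add: dist_norm add.assoc)
      also have "\<dots> \<le> a * norm u + b * norm v"
        using that norm_triangle_ineq[of "a *\<^sub>R u" "b *\<^sub>R v"] by simp
      also have "\<dots> \<le> s * norm u + s * norm v"
        using that by (intro add_mono mult_right_mono) auto
      also have "\<dots> < s * (norm u + norm v + 1)" using s by (simp add: algebra_simps)
      also have "\<dots> = d" using pos by (simp add: s_def)
      finally show ?thesis .
    qed
    have near': "dist (z + a *\<^sub>R v + b *\<^sub>R u) z < d" if "0 \<le> a" "a \<le> s" "0 \<le> b" "b \<le> s" for a b
      using near[of b a] that by (simp add: ac_simps)
    have "\<exists>a b. 0 \<le> a \<and> a \<le> s \<and> 0 \<le> b \<and> b \<le> s \<and>
      f (z + s *\<^sub>R u + s *\<^sub>R v) - f (z + s *\<^sub>R u) - f (z + s *\<^sub>R v) + f z =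
        s * s * ?H u v (z + a *\<^sub>R u + b *\<^sub>R v)"
      by (rule second_difference_mean_value[OF f s]) (use close near in simp)
    then obtain a b where ab: "0 \<le> a" "a \<le> s" "0 \<le> b" "b \<le> s"
      "f (z + s *\<^sub>R u + s *\<^sub>R v) - f (z + s *\<^sub>R u) - f (z + s *\<^sub>R v) + f z =
        s * s * ?H u v (z + a *\<^sub>R u + b *\<^sub>R v)"
      by (elim exE conjE)
    have "\<exists>a b. 0 \<le> a \<and> a \<le> s \<and> 0 \<le> b \<and> b \<le> s \<and>
      f (z + s *\<^sub>R v + s *\<^sub>R u) - f (z + s *\<^sub>R v) - f (z + s *\<^sub>R u) + f z =
        s * s * ?H v u (z + a *\<^sub>R v + b *\<^sub>R u)"
      by (rule second_difference_mean_value[OF f s]) (use close near' in simp)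
    then obtain a' b' where ab': "0 \<le> a'" "a' \<le> s" "0 \<le> b'" "b' \<le> s"
      "f (z + s *\<^sub>R v + s *\<^sub>R u) - f (z + s *\<^sub>R v) - f (z + s *\<^sub>R u) + f z =
        s * s * ?H v u (z + a' *\<^sub>R v + b' *\<^sub>R u)"
      by (elim exE conjE)
    have "s * s * ?H u v (z + a *\<^sub>R u + b *\<^sub>R v) = s * s * ?H v u (z + a' *\<^sub>R v + b' *\<^sub>R u)"
      using ab(5) ab'(5) by (simp add: algebra_simps)
    then have "?H u v (z + a *\<^sub>R u + b *\<^sub>R v) = ?H v u (z + a' *\<^sub>R v + b' *\<^sub>R u)"
      using s by simp
    then show ?thesis
      using close[OF near[OF ab(1-4)]] close[OF near'[OF ab'(1-4)]] by linarith
  qed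
  show ?thesis
  proof (rule ccontr)
    assume "?H u v z \<noteq> ?H v u z"
    then show False using le[of "\<bar>?H u v z - ?H v u z\<bar> / 2"] by simp
  qed
qed

lemma fd_bounded_linear:
  assumes "bounded_linear h" "f differentiable (at x)"
  shows "fd (\<lambda>x. h (f x)) x v = h (fd f x v)"
  using fd_eqI[OF bounded_linear.has_derivative[OF assms(1) has_derivative_fd[OF assms(2)]]] by simp

lemma fd_fd_commute:
  fixes f :: "'a::real_normed_vector \<Rightarrow> 'b::euclidean_space"
  assumes f: "smooth_on S f" and S: "open S" "z \<in> S"
  shows "fd (\<lambda>x. fd f x v) z u = fd (\<lambda>x. fd f x u) z v"
proof (rule euclidean_eqI)
  fix b :: 'b
  have "fd (\<lambda>x. fd f x v) z u \<bullet> b = fd (\<lambda>x. fd (\<lambda>x. f x \<bullet> b) x v) z u" for u v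
  proof -
    have "fd (\<lambda>x. fd (\<lambda>x. f x \<bullet> b) x v) z u = fd (\<lambda>x. fd f x v \<bullet> b) z u"
      by (rule fun_cong[OF fd_cong_open[OF S]])
        (rule fd_bounded_linear[OF bounded_linear_inner_left smooth_on_differentiable[OF f]])
    also have "\<dots> = fd (\<lambda>x. fd f x v) z u \<bullet> b"
      by (rule fd_bounded_linear[OF bounded_linear_inner_left smooth_on_differentiable[OF smooth_on_fd[OF f] S(2)]])
    finally show ?thesis by simp
  qed
  then show "fd (\<lambda>x. fd f x v) z u \<bullet> b = fd (\<lambda>x. fd f x u) z v \<bullet> b"
    using fd_fd_commute_real[OF smooth_on_bounded_linear[OF bounded_linear_inner_left S(1) f] S] by simp
qed

section \<open>Wedge products of covectors\<close>

lemma length_remove_nth [simp]: "i < length xs \<Longrightarrow> length (remove_nth i xs) = length xs - 1"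
  by (simp add: remove_nth_def)

lemma nth_remove_nth:
  assumes "i < length xs" "k < length xs - 1"
  shows "remove_nth i xs ! k = xs ! (if k < i then k else Suc k)"
  using assms by (auto simp: remove_nth_def nth_append min_def)

lemma map_remove_nth: "map f (remove_nth i xs) = remove_nth i (map f xs)"
  by (simp add: remove_nth_def take_map drop_map)

lemma remove_nth_Cons_0 [simp]: "remove_nth 0 (x # xs) = xs"
  by (simp add: remove_nth_def)

lemma remove_nth_update [simp]: "remove_nth k (xs[k := y]) = remove_nth k xs"
  by (simp add: remove_nth_def)

lemma remove_nth_append_Cons [simp]: "remove_nth (length xs) (xs @ y # ys) = xs @ ys"
  by (simp add: remove_nth_def)

lemma remove_nth_commute:
  assumes "k < i" "i < length xs"
  shows "remove_nth k (remove_nth i xs) = remove_nth (i - 1) (remove_nth k xs)"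
  using assms by (intro nth_equalityI) (auto simp: nth_remove_nth)

lemma sum_remove_nth_swap:
  fixes F :: "'v \<Rightarrow> 'v \<Rightarrow> 'v list \<Rightarrow> complex"
  shows "(\<Sum>i<length vs. \<Sum>k<length vs - 1. (-1) ^ (i + k) *
            F (vs ! i) (remove_nth i vs ! k) (remove_nth k (remove_nth i vs))) =
       - (\<Sum>i<length vs. \<Sum>k<length vs - 1. (-1) ^ (i + k) *
            F (remove_nth i vs ! k) (vs ! i) (remove_nth k (remove_nth i vs)))"
proof -
  define \<tau> where "\<tau> = (\<lambda>(i, k). if k < i then (k, i - 1) else (Suc k, i :: nat))"
  let ?D = "{..<length vs} \<times> {..<length vs - 1}"
  let ?f = "\<lambda>(i, k). (-1) ^ (i + k) * F (vs ! i) (remove_nth i vs ! k) (remove_nth k (remove_nth i vs))"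
  let ?g = "\<lambda>(i, k). - ((-1) ^ (i + k) * F (remove_nth i vs ! k) (vs ! i) (remove_nth k (remove_nth i vs)))"
  have inv: "\<tau> (\<tau> a) = a" for a by (auto simp: \<tau>_def split: prod.splits)
  have mem: "\<tau> a \<in> ?D" if "a \<in> ?D" for a using that by (auto simp: \<tau>_def)
  have eq: "?g (\<tau> a) = ?f a" if "a \<in> ?D" for a
  proof -
    obtain i k where a: "a = (i, k)" by (cases a)
    with that have ik: "i < length vs" "k < length vs - 1" by auto
    show ?thesis
    proof (cases "k < i")
      case True
      then obtain m where "i = Suc m" by (cases i) auto
      then show ?thesis
        using True ik by (simp add: a \<tau>_def nth_remove_nth remove_nth_commute add.commute)
    next
      case False
      then show ?thesis
        using ik by (simp add: a \<tau>_def nth_remove_nth remove_nth_commute[of i "Suc k"] add.commute)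
    qed
  qed
  have "sum ?f ?D = sum ?g ?D"
    by (rule sum.reindex_bij_witness[of _ \<tau> \<tau>]) (simp_all only: inv mem eq)
  then show ?thesis
    by (simp add: sum.cartesian_product sum_negf split_beta)
qed

lemma permutes_lessThan: "\<pi> permutes {..<n} \<Longrightarrow> i < n \<Longrightarrow> \<pi> i < (n::nat)"
  using permutes_in_image[of \<pi> "{..<n}" i] by simp

lemma wedge_eq_0: "length vs \<noteq> length as \<Longrightarrow> wedge as vs = 0"
  by (simp add: wedge_def)

definition wedge_mat :: "('v \<Rightarrow> complex) list \<Rightarrow> 'v list \<Rightarrow> complex mat" where
  "wedge_mat as vs = mat (length as) (length vs) (\<lambda>(i, j). (as ! i) (vs ! j))"

lemma wedge_eq_det: "length vs = length as \<Longrightarrow> wedge as vs = det (wedge_mat as vs)"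
  by (auto simp: wedge_def det_def wedge_mat_def permutes_lessThan simp flip: lessThan_atLeast0
      intro!: sum.cong prod.cong)

lemma mat_delete_wedge_mat:
  assumes "i < length as" "j < length vs"
  shows "mat_delete (wedge_mat as vs) i j = wedge_mat (remove_nth i as) (remove_nth j vs)"
  using assms by (intro eq_matI) (auto simp: mat_delete_def wedge_mat_def nth_remove_nth)

lemma wedge_expand_row:
  assumes "i < length as"
  shows "wedge as vs = (\<Sum>j<length vs. (-1) ^ (i + j) * (as ! i) (vs ! j) *
           wedge (remove_nth i as) (remove_nth j vs))"
proof (cases "length vs = length as")
  case True
  then have "wedge as vs = (\<Sum>j<length vs. wedge_mat as vs $$ (i, j) * cofactor (wedge_mat as vs) i j)"
    using assms by (simp add: wedge_eq_det) (rule laplace_expansion_row, auto simp: wedge_mat_def)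
  also have "\<dots> = (\<Sum>j<length vs. (-1) ^ (i + j) * (as ! i) (vs ! j) *
           wedge (remove_nth i as) (remove_nth j vs))"
    using True assms
    by (intro sum.cong) (auto simp: cofactor_def mat_delete_wedge_mat wedge_eq_det, simp add: wedge_mat_def)
  finally show ?thesis .
next
  case False
  then show ?thesis using assms by (auto simp: wedge_eq_0 intro!: sum.neutral)
qed

lemma wedge_expand_column:
  assumes "j < length vs"
  shows "wedge as vs = (\<Sum>i<length as. (-1) ^ (i + j) * (as ! i) (vs ! j) *
           wedge (remove_nth i as) (remove_nth j vs))"
proof (cases "length vs = length as")
  case True
  then have "wedge as vs = (\<Sum>i<length as. wedge_mat as vs $$ (i, j) * cofactor (wedge_mat as vs) i j)"
    using assms by (simp add: wedge_eq_det) (rule laplace_expansion_column, auto simp: wedge_mat_def)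
  also have "\<dots> = (\<Sum>i<length as. (-1) ^ (i + j) * (as ! i) (vs ! j) *
           wedge (remove_nth i as) (remove_nth j vs))"
    using True assms
    by (intro sum.cong) (auto simp: cofactor_def mat_delete_wedge_mat wedge_eq_det, simp add: wedge_mat_def)
  finally show ?thesis .
next
  case False
  then show ?thesis using assms by (auto simp: wedge_eq_0 intro!: sum.neutral)
qed

lemma wedge_move_vector:
  assumes "k < length vs"
  shows "wedge as vs = (-1) ^ k * wedge as (vs ! k # remove_nth k vs)"
  by (subst wedge_expand_column[OF assms], subst wedge_expand_column[of 0])
    (auto simp: sum_distrib_left power_add intro!: sum.cong)

lemma wedge_move_covector:
  assumes "k < length as"
  shows "wedge as vs = (-1) ^ k * wedge (as ! k # remove_nth k as) vs"
  by (subst wedge_expand_row[OF assms], subst wedge_expand_row[of 0])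
    (auto simp: sum_distrib_left power_add intro!: sum.cong)

lemma wedge_Cons:
  "wedge (a # as) vs = (\<Sum>i<length vs. (-1) ^ i * a (vs ! i) * wedge as (remove_nth i vs))"
  using wedge_expand_row[of 0 "a # as" vs] by simp

lemma has_derivative_wedge:
  fixes L :: "'a::real_normed_vector \<Rightarrow> 'v \<Rightarrow> 'w::real_normed_vector"
  assumes as: "\<And>a. a \<in> set as \<Longrightarrow> bounded_linear a"
    and L: "\<And>v. ((\<lambda>w. L w v) has_derivative L' v) (at z)"
  shows "((\<lambda>w. wedge as (map (L w) vs)) has_derivative
    (\<lambda>h. \<Sum>k<length vs. (-1) ^ k * wedge as (L' (vs ! k) h # remove_nth k (map (L z) vs)))) (at z)"
proof (cases "length vs = length as")
  case False
  then show ?thesis by (simp add: wedge_eq_0)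
next
  case True
  let ?n = "length as" and ?xs = "map (L z) vs"
  let ?P = "{\<pi>. \<pi> permutes {..<?n}}"
  let ?D = "\<lambda>h \<pi> i. (as ! i) (L' (vs ! \<pi> i) h) * (\<Prod>j\<in>{..<?n} - {i}. (as ! j) (?xs ! \<pi> j))"
  have "((\<lambda>w. \<Sum>\<pi>\<in>?P. of_int (sign \<pi>) * (\<Prod>i<?n. (as ! i) (L w (vs ! \<pi> i)))) has_derivative
    (\<lambda>h. \<Sum>\<pi>\<in>?P. of_int (sign \<pi>) * (\<Sum>i<?n. (as ! i) (L' (vs ! \<pi> i) h) *
       (\<Prod>j\<in>{..<?n} - {i}. (as ! j) (L z (vs ! \<pi> j)))))) (at z)"
    by (intro has_derivative_sum has_derivative_mult_right has_derivative_prod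
        bounded_linear.has_derivative[OF as L]) simp
  moreover have "(\<Prod>i<?n. (as ! i) (L w (vs ! \<pi> i))) = (\<Prod>i<?n. (as ! i) (map (L w) vs ! \<pi> i))"
    if "\<pi> \<in> ?P" for w \<pi>
    using that True by (intro prod.cong) (auto simp: permutes_lessThan)
  moreover have "(\<Prod>j\<in>{..<?n} - {i}. (as ! j) (L z (vs ! \<pi> j))) =
      (\<Prod>j\<in>{..<?n} - {i}. (as ! j) (?xs ! \<pi> j))" if "\<pi> \<in> ?P" for i \<pi>
    using that True by (intro prod.cong) (auto simp: permutes_lessThan)
  ultimately have "((\<lambda>w. wedge as (map (L w) vs)) has_derivative
      (\<lambda>h. \<Sum>\<pi>\<in>?P. of_int (sign \<pi>) * (\<Sum>i<?n. ?D h \<pi> i))) (at z)"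
    using True by (simp add: wedge_def)
  moreover have "(\<Sum>\<pi>\<in>?P. of_int (sign \<pi>) * (\<Sum>i<?n. ?D h \<pi> i)) =
      (\<Sum>k<length vs. (-1) ^ k * wedge as (L' (vs ! k) h # remove_nth k ?xs))" for h
  proof -
    let ?E = "\<lambda>\<pi> k. \<Prod>j<?n. (as ! j) (?xs[k := L' (vs ! k) h] ! \<pi> j)"
    have D: "?D h \<pi> i = ?E \<pi> (\<pi> i)" if "\<pi> \<in> ?P" "i < ?n" for \<pi> i
    proof -
      have \<pi>: "\<pi> permutes {..<?n}" using that by simp
      have "?E \<pi> (\<pi> i) = (as ! i) (?xs[\<pi> i := L' (vs ! \<pi> i) h] ! \<pi> i) *
          (\<Prod>j\<in>{..<?n} - {i}. (as ! j) (?xs[\<pi> i := L' (vs ! \<pi> i) h] ! \<pi> j))"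
        using that(2) by (subst prod.remove[of _ i]) auto
      also have "(\<Prod>j\<in>{..<?n} - {i}. (as ! j) (?xs[\<pi> i := L' (vs ! \<pi> i) h] ! \<pi> j)) =
          (\<Prod>j\<in>{..<?n} - {i}. (as ! j) (?xs ! \<pi> j))"
        using permutes_inj[OF \<pi>] by (intro prod.cong) (auto simp: inj_eq)
      also have "?xs[\<pi> i := L' (vs ! \<pi> i) h] ! \<pi> i = L' (vs ! \<pi> i) h"
        using permutes_in_image[OF \<pi>] that(2) True by simp
      finally show ?thesis by simp
    qed
    have DE: "(\<Sum>i<?n. ?D h \<pi> i) = (\<Sum>k<?n. ?E \<pi> k)" if "\<pi> \<in> ?P" for \<pi>
    proof -
      have "(\<Sum>i<?n. ?D h \<pi> i) = (\<Sum>i<?n. ?E \<pi> (\<pi> i))"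
        using D[OF that] by (intro sum.cong) simp_all
      also have "\<dots> = (\<Sum>k<?n. ?E \<pi> k)"
        using that sum.permute[of \<pi> "{..<?n}" "?E \<pi>"] by (simp add: comp_def)
      finally show ?thesis .
    qed
    have "(\<Sum>\<pi>\<in>?P. of_int (sign \<pi>) * (\<Sum>i<?n. ?D h \<pi> i)) =
        (\<Sum>\<pi>\<in>?P. of_int (sign \<pi>) * (\<Sum>k<?n. ?E \<pi> k))"
      by (rule sum.cong[OF refl]) (simp only: DE)
    also have "\<dots> = (\<Sum>k<?n. \<Sum>\<pi>\<in>?P. of_int (sign \<pi>) * ?E \<pi> k)"
      unfolding sum_distrib_left by (rule sum.swap)
    also have "\<dots> = (\<Sum>k<?n. wedge as (?xs[k := L' (vs ! k) h]))"
      using True by (simp add: wedge_def)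
    also have "\<dots> = (\<Sum>k<length vs. (-1) ^ k * wedge as (L' (vs ! k) h # remove_nth k ?xs))"
      using True by (intro sum.cong) (simp_all add: wedge_move_vector[of k "?xs[k := _]" for k])
    finally show ?thesis .
  qed
  ultimately show ?thesis by simp
qed

section \<open>The operators on local forms\<close>

text \<open>The operator \<open>cderiv \<sigma>\<close> is \<open>\<Sum>\<^sub>j dz\<^sub>j \<partial>/\<partial>z\<^sub>j\<close> for \<open>\<sigma> = \<i>\<close> and \<open>\<Sum>\<^sub>j dzbar\<^sub>j \<partial>/\<partial>zbar\<^sub>j\<close>
  for \<open>\<sigma> = -\<i>\<close>, so that \<open>\<partial>\<close> and \<open>\<partial>bar\<close> are treated together.\<close>

definition cderiv :: "complex \<Rightarrow> (complex^'n::finite \<Rightarrow> complex) \<Rightarrow> complex^'n \<Rightarrow> complex^'n \<Rightarrow> complex" where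
  "cderiv \<sigma> f z v = (fd f z v - \<sigma> * fd f z (\<i> *s v)) / 2"

definition local_d ::
  "complex \<Rightarrow> (complex^'n::finite \<Rightarrow> (complex^'n) list \<Rightarrow> complex) \<Rightarrow> complex^'n \<Rightarrow> (complex^'n) list \<Rightarrow> complex" where
  "local_d \<sigma> \<alpha> z vs = (\<Sum>i<length vs. (-1) ^ i * cderiv \<sigma> (\<lambda>w. \<alpha> w (remove_nth i vs)) z (vs ! i))"

lemma fd_eq_sum_axis:
  fixes f :: "complex^'n::finite \<Rightarrow> complex"
  assumes "f differentiable (at z)"
  shows "fd f z v = (\<Sum>j\<in>UNIV. of_real (Re (v $ j)) * fd f z (axis j 1) + of_real (Im (v $ j)) * fd f z (axis j \<i>))"
proof -
  interpret linear "fd f z" by (rule linear_fd[OF assms])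
  have "v = (\<Sum>j\<in>UNIV. Re (v $ j) *\<^sub>R axis j 1 + Im (v $ j) *\<^sub>R axis j \<i>)"
    by (simp add: Finite_Cartesian_Product.vec_eq_iff axis_def if_distrib sum.delta complex_eq_iff cong: if_cong)
  then have "fd f z v = fd f z (\<Sum>j\<in>UNIV. Re (v $ j) *\<^sub>R axis j 1 + Im (v $ j) *\<^sub>R axis j \<i>)"
    by simp
  then show ?thesis by (simp add: sum add scale) (simp add: scaleR_conv_of_real)
qed

lemma cderiv_eq_deriv_z:
  assumes "f differentiable (at z)"
  shows "cderiv \<i> f z v = (\<Sum>j\<in>UNIV. dz j v * deriv_z j f z)"
  unfolding cderiv_def fd_eq_sum_axis[OF assms, of v] fd_eq_sum_axis[OF assms, of "\<i> *s v"]
  unfolding sum_distrib_left sum_subtractf[symmetric] sum_divide_distrib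
proof (rule sum.cong[OF refl])
  fix j
  obtain x y where v: "v $ j = Complex x y" by (cases "v $ j")
  show "(of_real (Re (v $ j)) * fd f z (axis j 1) + of_real (Im (v $ j)) * fd f z (axis j \<i>) -
      \<i> * (of_real (Re ((\<i> *s v) $ j)) * fd f z (axis j 1) + of_real (Im ((\<i> *s v) $ j)) * fd f z (axis j \<i>))) / 2 =
    dz j v * deriv_z j f z"
    by (simp add: v dz_def deriv_z_def) (simp add: Complex_eq field_simps)
qed

lemma cderiv_eq_deriv_zbar:
  assumes "f differentiable (at z)"
  shows "cderiv (- \<i>) f z v = (\<Sum>j\<in>UNIV. dzbar j v * deriv_zbar j f z)"
  unfolding cderiv_def fd_eq_sum_axis[OF assms, of v] fd_eq_sum_axis[OF assms, of "\<i> *s v"]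
  unfolding sum_distrib_left sum_subtractf[symmetric] sum_divide_distrib
proof (rule sum.cong[OF refl])
  fix j
  obtain x y where v: "v $ j = Complex x y" by (cases "v $ j")
  show "(of_real (Re (v $ j)) * fd f z (axis j 1) + of_real (Im (v $ j)) * fd f z (axis j \<i>) -
      - \<i> * (of_real (Re ((\<i> *s v) $ j)) * fd f z (axis j 1) + of_real (Im ((\<i> *s v) $ j)) * fd f z (axis j \<i>))) / 2 =
    dzbar j v * deriv_zbar j f z"
    by (simp add: v dzbar_def deriv_zbar_def) (simp add: complex_cnj Complex_eq field_simps)
qed

lemma local_del_eq: "(\<And>us. (\<lambda>w. \<alpha> w us) differentiable (at z)) \<Longrightarrow> local_del \<alpha> z vs = local_d \<i> \<alpha> z vs"
  by (simp add: local_del_def local_d_def cderiv_eq_deriv_z sum_distrib_left mult.assoc)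

lemma local_delbar_eq:
  "(\<And>us. (\<lambda>w. \<alpha> w us) differentiable (at z)) \<Longrightarrow> local_delbar \<alpha> z vs = local_d (- \<i>) \<alpha> z vs"
  by (simp add: local_delbar_def local_d_def cderiv_eq_deriv_zbar sum_distrib_left mult.assoc)

lemma cderiv_cong_open:
  assumes "open S" "z \<in> S" "\<And>w. w \<in> S \<Longrightarrow> f w = g w"
  shows "cderiv \<sigma> f z = cderiv \<sigma> g z"
  by (simp add: cderiv_def fun_eq_iff fd_cong_open[OF assms])

lemma local_d_cong:
  assumes "open S" "z \<in> S" "\<And>w us. w \<in> S \<Longrightarrow> \<alpha> w us = \<beta> w us"
  shows "local_d \<sigma> \<alpha> z vs = local_d \<sigma> \<beta> z vs"
proof -
  have "cderiv \<sigma> (\<lambda>w. \<alpha> w us) z = cderiv \<sigma> (\<lambda>w. \<beta> w us) z" for us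
    using assms by (intro cderiv_cong_open) auto
  then show ?thesis by (simp add: local_d_def)
qed

lemma cderiv_add:
  assumes "f differentiable (at z)" "g differentiable (at z)"
  shows "cderiv \<sigma> (\<lambda>w. f w + g w) z v = cderiv \<sigma> f z v + cderiv \<sigma> g z v"
  by (simp add: cderiv_def fd_eqI[OF has_derivative_add[OF assms[THEN has_derivative_fd]]] field_simps)

lemma cderiv_cmult:
  assumes "f differentiable (at z)"
  shows "cderiv \<sigma> (\<lambda>w. c * f w) z v = c * cderiv \<sigma> f z v"
  by (simp add: cderiv_def fd_bounded_linear[OF bounded_linear_mult_right assms] field_simps)

lemma cderiv_zero [simp]: "cderiv \<sigma> (\<lambda>_. 0) z v = 0"
  by (simp add: cderiv_def)

lemma cderiv_sum:
  assumes "finite T" "\<And>t. t \<in> T \<Longrightarrow> f t differentiable (at z)"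
  shows "cderiv \<sigma> (\<lambda>w. \<Sum>t\<in>T. f t w) z v = (\<Sum>t\<in>T. cderiv \<sigma> (f t) z v)"
  using assms by (induction T) (auto simp: cderiv_add)

lemma smooth_on_cderiv:
  assumes "open S" "smooth_on S f"
  shows "smooth_on S (\<lambda>z. cderiv \<sigma> f z v)"
proof -
  have "smooth_on S (\<lambda>z. (1/2) * (fd f z v + (- \<sigma>) * fd f z (\<i> *s v)))"
    by (intro smooth_on_cmult smooth_on_add smooth_on_fd assms)
  then show ?thesis by (simp add: cderiv_def[abs_def])
qed

lemma cderiv_commute:
  assumes S: "open S" "z \<in> S" and f: "smooth_on S f"
  shows "cderiv \<sigma> (\<lambda>w. cderiv \<tau> f w b) z a = cderiv \<tau> (\<lambda>w. cderiv \<sigma> f w a) z b"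
proof -
  have 0: "fd (\<lambda>w. cderiv \<tau> f w b) z a =
      (fd (\<lambda>w. fd f w b) z a - \<tau> * fd (\<lambda>w. fd f w (\<i> *s b)) z a) / 2" for \<tau> a b
  proof -
    have "((\<lambda>w. fd f w v) has_derivative fd (\<lambda>w. fd f w v) z) (at z)" for v
      using has_derivative_smooth[OF smooth_on_fd[OF f] S(2)] .
    then have "((\<lambda>w. cderiv \<tau> f w b) has_derivative
        (\<lambda>a. (fd (\<lambda>w. fd f w b) z a - \<tau> * fd (\<lambda>w. fd f w (\<i> *s b)) z a) / 2)) (at z)"
      unfolding cderiv_def
      by (intro bounded_linear.has_derivative[OF bounded_linear_divide] has_derivative_diff has_derivative_mult_right)
    then show ?thesis by (simp add: fd_eqI)
  qed
  have 1: "cderiv \<sigma> (\<lambda>w. cderiv \<tau> f w b) z a =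
      (fd (\<lambda>w. fd f w b) z a - \<tau> * fd (\<lambda>w. fd f w (\<i> *s b)) z a -
       \<sigma> * (fd (\<lambda>w. fd f w b) z (\<i> *s a) - \<tau> * fd (\<lambda>w. fd f w (\<i> *s b)) z (\<i> *s a))) / 4" for \<sigma> \<tau> a b
    unfolding cderiv_def[of _ "\<lambda>w. cderiv \<tau> f w b"] 0 by (simp add: field_simps)
  show ?thesis
    unfolding 1 fd_fd_commute[OF f S, of a] fd_fd_commute[OF f S, of "\<i> *s a"]
    by (simp add: algebra_simps)
qed

lemma local_d_anticommute:
  assumes S: "open S" "z \<in> S" and \<alpha>: "\<And>us. smooth_on S (\<lambda>w. \<alpha> w us)"
  shows "local_d \<sigma> (local_d \<tau> \<alpha>) z vs = - local_d \<tau> (local_d \<sigma> \<alpha>) z vs"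
proof -
  let ?F = "\<lambda>\<sigma> \<tau> a b r. cderiv \<sigma> (\<lambda>w. cderiv \<tau> (\<lambda>w. \<alpha> w r) w b) z a"
  have "local_d \<sigma> (local_d \<tau> \<alpha>) z vs = (\<Sum>i<length vs. \<Sum>k<length vs - 1. (-1) ^ (i + k) *
      ?F \<sigma> \<tau> (vs ! i) (remove_nth i vs ! k) (remove_nth k (remove_nth i vs)))" for \<sigma> \<tau>
  proof -
    have "cderiv \<sigma> (\<lambda>w. local_d \<tau> \<alpha> w (remove_nth i vs)) z (vs ! i) = (\<Sum>k<length vs - 1. (-1) ^ k *
      ?F \<sigma> \<tau> (vs ! i) (remove_nth i vs ! k) (remove_nth k (remove_nth i vs)))" if "i < length vs" for i
    proof -
      have d: "(\<lambda>w. cderiv \<tau> (\<lambda>w. \<alpha> w r) w b) differentiable (at z)" for r b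
        by (rule smooth_on_differentiable[OF smooth_on_cderiv[OF S(1) \<alpha>] S(2)])
      then have d': "(\<lambda>w. (-1) ^ k * cderiv \<tau> (\<lambda>w. \<alpha> w r) w b) differentiable (at z)" for r b k
        by (intro differentiable_mult) simp_all
      show ?thesis
        using that by (simp add: local_d_def cderiv_sum[OF finite_lessThan d'] cderiv_cmult[OF d])
    qed
    then show ?thesis
      by (simp add: local_d_def[of \<sigma>] sum_distrib_left power_add mult.assoc)
  qed
  then show ?thesis
    by (simp only: sum_remove_nth_swap[where F = "?F \<sigma> \<tau>"] cderiv_commute[OF S \<alpha>])
qed

lemma finite_lists_length: "finite {I :: 'n::finite list. length I = p}"
  using finite_lists_length_eq[OF finite[of "UNIV :: 'n set"], of p] by simp

lemma sum_lists_Suc: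
  fixes h :: "'n::finite list \<Rightarrow> 'b::comm_monoid_add"
  shows "(\<Sum>I | length I = Suc p. h I) = (\<Sum>j\<in>UNIV. \<Sum>I | length I = p. h (j # I))"
  unfolding sum.cartesian_product
  by (rule sum.reindex_bij_witness[of _ "\<lambda>(j, I). j # I" "\<lambda>I. (hd I, tl I)"])
    (auto simp: length_Suc_conv)

lemma local_d_expansion:
  assumes S: "open S" "z \<in> S" and f: "\<And>I J. smooth_on S (f I J)"
    and \<alpha>: "\<And>z vs. z \<in> S \<Longrightarrow> \<alpha> z vs =
      (\<Sum>I | length I = p. \<Sum>J | length J = q. f I J z * wedge (map dz I @ map dzbar J) vs)"
    and e: "\<And>f v. f differentiable (at z) \<Longrightarrow> cderiv \<sigma> f z v = (\<Sum>j\<in>UNIV. e j v * D j f z)"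
  shows "local_d \<sigma> \<alpha> z vs =
    (\<Sum>j\<in>UNIV. \<Sum>I | length I = p. \<Sum>J | length J = q. D j (f I J) z * wedge (e j # map dz I @ map dzbar J) vs)"
proof -
  let ?T = "{I :: 'a list. length I = p} \<times> {J :: 'a list. length J = q}"
  let ?as = "\<lambda>t. map dz (fst t) @ map dzbar (snd t) :: (complex^'a \<Rightarrow> complex) list"
  let ?f = "\<lambda>t. f (fst t) (snd t)"
  have fin: "finite ?T" by (simp add: finite_lists_length)
  have d: "?f t differentiable (at z)" for t by (rule smooth_on_differentiable[OF f S(2)])
  then have d': "(\<lambda>w. wedge as vs * ?f t w) differentiable (at z)" for t as vs
    by (intro differentiable_mult) simp_all
  have "local_d \<sigma> \<alpha> z vs = local_d \<sigma> (\<lambda>z vs. \<Sum>t\<in>?T. wedge (?as t) vs * ?f t z) z vs"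
    by (rule local_d_cong[OF S]) (simp add: \<alpha> sum.cartesian_product split_beta mult.commute)
  also have "\<dots> = (\<Sum>i<length vs. \<Sum>t\<in>?T. \<Sum>j\<in>UNIV. (-1) ^ i * wedge (?as t) (remove_nth i vs) * (e j (vs ! i) * D j (?f t) z))"
    by (simp add: local_d_def cderiv_sum[OF fin d'] cderiv_cmult[OF d] e[OF d] sum_distrib_left mult.assoc)
  also have "\<dots> = (\<Sum>t\<in>?T. \<Sum>i<length vs. \<Sum>j\<in>UNIV. (-1) ^ i * wedge (?as t) (remove_nth i vs) * (e j (vs ! i) * D j (?f t) z))"
    by (rule sum.swap)
  also have "\<dots> = (\<Sum>t\<in>?T. \<Sum>j\<in>UNIV. \<Sum>i<length vs. (-1) ^ i * wedge (?as t) (remove_nth i vs) * (e j (vs ! i) * D j (?f t) z))"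
    by (intro sum.cong[OF refl] sum.swap)
  also have "\<dots> = (\<Sum>j\<in>UNIV. \<Sum>t\<in>?T. \<Sum>i<length vs. (-1) ^ i * wedge (?as t) (remove_nth i vs) * (e j (vs ! i) * D j (?f t) z))"
    by (rule sum.swap)
  also have "\<dots> = (\<Sum>j\<in>UNIV. \<Sum>t\<in>?T. D j (?f t) z * wedge (e j # ?as t) vs)"
    by (simp add: wedge_Cons sum_distrib_left mult_ac)
  finally show ?thesis
    by (simp add: sum.cartesian_product split_beta)
qed

lemma smooth_on_deriv_z: "open S \<Longrightarrow> smooth_on S f \<Longrightarrow> smooth_on S (deriv_z j f)"
  and smooth_on_deriv_zbar: "open S \<Longrightarrow> smooth_on S f \<Longrightarrow> smooth_on S (deriv_zbar j f)"
proof -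
  assume *: "open S" "smooth_on S f"
  have "smooth_on S (\<lambda>z. (1/2) * (fd f z (axis j 1) + s * fd f z (axis j \<i>)))" for s
    by (intro smooth_on_cmult smooth_on_add smooth_on_fd *)
  from this[of "- \<i>"] this[of \<i>]
  show "smooth_on S (deriv_z j f)" "smooth_on S (deriv_zbar j f)"
    by (simp_all add: deriv_z_def[abs_def] deriv_zbar_def[abs_def])
qed

lemma local_form_local_del:
  assumes S: "open S" and \<alpha>: "local_form p q S \<alpha>"
  shows "local_form (Suc p) q S (local_d \<i> \<alpha>)"
proof -
  obtain f where f: "\<And>I J. smooth_on S (f I J)" and \<alpha>: "\<And>z vs. z \<in> S \<Longrightarrow> \<alpha> z vs =
      (\<Sum>I | length I = p. \<Sum>J | length J = q. f I J z * wedge (map dz I @ map dzbar J) vs)"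
    using \<alpha> unfolding local_form_def by blast
  show ?thesis
    unfolding local_form_def
  proof (intro exI[of _ "\<lambda>I J. deriv_z (hd I) (f (tl I) J)"] conjI allI ballI)
    fix z vs assume "z \<in> S"
    then show "local_d \<i> \<alpha> z vs = (\<Sum>I | length I = Suc p. \<Sum>J | length J = q.
        deriv_z (hd I) (f (tl I) J) z * wedge (map dz I @ map dzbar J) vs)"
      by (simp add: sum_lists_Suc local_d_expansion[where D = deriv_z and e = dz, OF S _ f \<alpha> cderiv_eq_deriv_z])
  qed (simp add: smooth_on_deriv_z S f)
qed

lemma local_form_local_delbar:
  assumes S: "open S" and \<alpha>: "local_form p q S \<alpha>"
  shows "local_form p (Suc q) S (local_d (- \<i>) \<alpha>)"
proof -
  obtain f where f: "\<And>I J. smooth_on S (f I J)" and \<alpha>: "\<And>z vs. z \<in> S \<Longrightarrow> \<alpha> z vs =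
      (\<Sum>I | length I = p. \<Sum>J | length J = q. f I J z * wedge (map dz I @ map dzbar J) vs)"
    using \<alpha> unfolding local_form_def by blast
  show ?thesis
    unfolding local_form_def
  proof (intro exI[of _ "\<lambda>I J z. (-1) ^ p * deriv_zbar (hd J) (f I (tl J)) z"] conjI allI ballI)
    fix z vs assume z: "z \<in> S"
    have "wedge (dzbar j # map dz I @ map dzbar J) vs = (-1) ^ p * wedge (map dz I @ map dzbar (j # J)) vs"
      if "length I = p" for j :: 'a and I J
      using wedge_move_covector[of p "map dz I @ dzbar j # map dzbar J" vs]
        remove_nth_append_Cons[of "map dz I" "dzbar j" "map dzbar J"] that
      by (simp add: nth_append)
    then have "local_d (- \<i>) \<alpha> z vs = (\<Sum>j\<in>UNIV. \<Sum>I | length I = p. \<Sum>J | length J = q.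
        deriv_zbar j (f I J) z * ((-1) ^ p * wedge (map dz I @ map dzbar (j # J)) vs))"
      by (simp add: local_d_expansion[where D = deriv_zbar and e = dzbar, OF S z f \<alpha> cderiv_eq_deriv_zbar])
    also have "\<dots> = (\<Sum>I | length I = p. \<Sum>j\<in>UNIV. \<Sum>J | length J = q.
        deriv_zbar j (f I J) z * ((-1) ^ p * wedge (map dz I @ map dzbar (j # J)) vs))"
      by (rule sum.swap)
    finally show "local_d (- \<i>) \<alpha> z vs = (\<Sum>I | length I = p. \<Sum>J | length J = Suc q.
        (-1) ^ p * deriv_zbar (hd J) (f I (tl J)) z * wedge (map dz I @ map dzbar J) vs)"
      by (simp add: sum_lists_Suc mult_ac)
  qed (intro smooth_on_cmult smooth_on_deriv_zbar S f)
qed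

lemma local_form_smooth:
  assumes S: "open S" and \<alpha>: "local_form p q S \<alpha>"
  shows "smooth_on S (\<lambda>z. \<alpha> z vs)"
proof -
  obtain f where f: "\<And>I J. smooth_on S (f I J)" and \<alpha>: "\<And>z vs. z \<in> S \<Longrightarrow> \<alpha> z vs =
      (\<Sum>I | length I = p. \<Sum>J | length J = q. f I J z * wedge (map dz I @ map dzbar J) vs)"
    using \<alpha> unfolding local_form_def by blast
  have "smooth_on S (\<lambda>z. \<Sum>I | length I = p. \<Sum>J | length J = q. wedge (map dz I @ map dzbar J) vs * f I J z)"
    by (intro smooth_on_sum smooth_on_cmult S f)
  then show ?thesis
    by (subst smooth_on_cong[OF S \<alpha>]) (simp_all add: mult.commute)
qed

section \<open>Pullback of forms and global forms\<close>

lemma local_form_add: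
  assumes S: "open S" and \<alpha>: "local_form p q S \<alpha>" and \<beta>: "local_form p q S \<beta>"
  shows "local_form p q S (\<lambda>z vs. \<alpha> z vs + \<beta> z vs)"
proof -
  obtain f where f: "\<And>I J. smooth_on S (f I J)" "\<And>z vs. z \<in> S \<Longrightarrow> \<alpha> z vs =
      (\<Sum>I | length I = p. \<Sum>J | length J = q. f I J z * wedge (map dz I @ map dzbar J) vs)"
    using \<alpha> unfolding local_form_def by blast
  obtain g where g: "\<And>I J. smooth_on S (g I J)" "\<And>z vs. z \<in> S \<Longrightarrow> \<beta> z vs =
      (\<Sum>I | length I = p. \<Sum>J | length J = q. g I J z * wedge (map dz I @ map dzbar J) vs)"
    using \<beta> unfolding local_form_def by blast
  show ?thesis
    unfolding local_form_def
    by (intro exI[of _ "\<lambda>I J z. f I J z + g I J z"] conjI allI ballI smooth_on_add S f(1) g(1))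
      (simp add: f(2) g(2) distrib_right sum.distrib)
qed

lemma local_form_scale:
  assumes S: "open S" and \<alpha>: "local_form p q S \<alpha>"
  shows "local_form p q S (\<lambda>z vs. a * \<alpha> z vs)"
proof -
  obtain f where f: "\<And>I J. smooth_on S (f I J)" "\<And>z vs. z \<in> S \<Longrightarrow> \<alpha> z vs =
      (\<Sum>I | length I = p. \<Sum>J | length J = q. f I J z * wedge (map dz I @ map dzbar J) vs)"
    using \<alpha> unfolding local_form_def by blast
  show ?thesis
    unfolding local_form_def
    by (intro exI[of _ "\<lambda>I J z. a * f I J z"] conjI allI ballI smooth_on_cmult S f(1))
      (simp add: f(2) sum_distrib_left mult.assoc)
qed

lemma bounded_linear_dz: "bounded_linear (dz j)"
  using bounded_linear_vec_nth by (simp add: dz_def[abs_def])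

lemma bounded_linear_dzbar: "bounded_linear (dzbar j)"
  using bounded_linear_compose[OF bounded_linear_cnj bounded_linear_vec_nth]
  by (simp add: dzbar_def[abs_def])

lemma bounded_linear_ii: "bounded_linear (\<lambda>v :: complex^'n::finite. \<i> *s v)"
proof -
  have "linear (\<lambda>v :: complex^'n. \<i> *s v)"
    by (rule linearI) (simp_all add: Finite_Cartesian_Product.vec_eq_iff distrib_left)
  then show ?thesis by (simp add: linear_conv_bounded_linear)
qed

lemma has_derivative_pullback:
  fixes \<phi> :: "complex^'n::finite \<Rightarrow> complex^'n"
  assumes T: "open T" "\<phi> z \<in> T" and \<beta>: "local_form p q T \<beta>" and S: "open S" "z \<in> S" and \<phi>: "smooth_on S \<phi>"
    and ST: "\<And>w. w \<in> S \<Longrightarrow> \<phi> w \<in> T"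
  shows "((\<lambda>w. \<beta> (\<phi> w) (map (fd \<phi> w) us)) has_derivative
    (\<lambda>h. fd (\<lambda>x. \<beta> x (map (fd \<phi> z) us)) (\<phi> z) (fd \<phi> z h) +
      (\<Sum>k<length us. (-1) ^ k * \<beta> (\<phi> z) (fd (\<lambda>w. fd \<phi> w (us ! k)) z h # remove_nth k (map (fd \<phi> z) us))))) (at z)"
proof -
  obtain f where f: "\<And>I J. smooth_on T (f I J)" and \<beta>_eq: "\<And>z vs. z \<in> T \<Longrightarrow> \<beta> z vs =
      (\<Sum>I | length I = p. \<Sum>J | length J = q. f I J z * wedge (map dz I @ map dzbar J) vs)"
    using \<beta> unfolding local_form_def by blast
  let ?T = "{I :: 'n list. length I = p} \<times> {J :: 'n list. length J = q}"
  let ?as = "\<lambda>t. map dz (fst t) @ map dzbar (snd t) :: (complex^'n \<Rightarrow> complex) list"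
  let ?f = "\<lambda>t. f (fst t) (snd t)"
  let ?W = "\<lambda>h t. \<Sum>k<length us. (-1) ^ k * wedge (?as t) (fd (\<lambda>w. fd \<phi> w (us ! k)) z h # remove_nth k (map (fd \<phi> z) us))"
  have \<beta>_eq: "\<beta> z vs = (\<Sum>t\<in>?T. ?f t z * wedge (?as t) vs)" if "z \<in> T" for z vs
    using \<beta>_eq[OF that] by (simp add: sum.cartesian_product split_beta)
  have d\<phi>: "(\<phi> has_derivative fd \<phi> z) (at z)"
    by (rule has_derivative_smooth[OF \<phi> S(2)])
  have df: "((\<lambda>w. ?f t (\<phi> w)) has_derivative (\<lambda>h. fd (?f t) (\<phi> z) (fd \<phi> z h))) (at z)" for t
    by (rule has_derivative_compose[OF d\<phi> has_derivative_smooth[OF f T(2)]])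
  have dw: "((\<lambda>w. wedge (?as t) (map (fd \<phi> w) us)) has_derivative (\<lambda>h. ?W h t)) (at z)" for t
    by (rule has_derivative_wedge)
      (auto simp: bounded_linear_dz bounded_linear_dzbar has_derivative_smooth[OF smooth_on_fd[OF \<phi>] S(2)])
  have "((\<lambda>w. \<Sum>t\<in>?T. ?f t (\<phi> w) * wedge (?as t) (map (fd \<phi> w) us)) has_derivative
    (\<lambda>h. \<Sum>t\<in>?T. ?f t (\<phi> z) * ?W h t + fd (?f t) (\<phi> z) (fd \<phi> z h) * wedge (?as t) (map (fd \<phi> z) us))) (at z)"
    by (intro has_derivative_sum has_derivative_mult df dw)
  then have "((\<lambda>w. \<beta> (\<phi> w) (map (fd \<phi> w) us)) has_derivative
    (\<lambda>h. \<Sum>t\<in>?T. ?f t (\<phi> z) * ?W h t + fd (?f t) (\<phi> z) (fd \<phi> z h) * wedge (?as t) (map (fd \<phi> z) us))) (at z)"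
    by (subst has_derivative_cong_open[OF S]) (simp_all add: \<beta>_eq ST)
  moreover have "fd (\<lambda>x. \<beta> x vs) (\<phi> z) h = (\<Sum>t\<in>?T. fd (?f t) (\<phi> z) h * wedge (?as t) vs)" for vs h
  proof -
    have "((\<lambda>x. \<Sum>t\<in>?T. ?f t x * wedge (?as t) vs) has_derivative
        (\<lambda>h. \<Sum>t\<in>?T. fd (?f t) (\<phi> z) h * wedge (?as t) vs)) (at (\<phi> z))"
      by (intro has_derivative_sum has_derivative_mult_left has_derivative_smooth[OF f T(2)])
    then have "((\<lambda>x. \<beta> x vs) has_derivative (\<lambda>h. \<Sum>t\<in>?T. fd (?f t) (\<phi> z) h * wedge (?as t) vs)) (at (\<phi> z))"
      by (subst has_derivative_cong_open[OF T]) (simp_all add: \<beta>_eq)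
    then show ?thesis by (simp add: fd_eqI)
  qed
  moreover have "(\<Sum>k<length us. (-1) ^ k * \<beta> (\<phi> z) (fd (\<lambda>w. fd \<phi> w (us ! k)) z h # remove_nth k (map (fd \<phi> z) us))) =
      (\<Sum>t\<in>?T. ?f t (\<phi> z) * ?W h t)" for h
    unfolding \<beta>_eq[OF T(2)] sum_distrib_left
    by (subst sum.swap) (simp add: mult_ac)
  ultimately show ?thesis
    by (simp add: sum.distrib add.commute)
qed

text \<open>The terms with second derivatives of \<open>\<phi>\<close> are symmetric in two of the vectors, hence cancel in
  the alternating sum.\<close>

lemma local_d_pullback:
  fixes \<phi> :: "complex^'n::finite \<Rightarrow> complex^'n"
  assumes T: "open T" and \<beta>: "local_form p q T \<beta>" and S: "open S" "z \<in> S"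
    and \<phi>: "holomorphic_map_on S \<phi>" and ST: "\<And>w. w \<in> S \<Longrightarrow> \<phi> w \<in> T"
  shows "local_d \<sigma> (\<lambda>w vs. \<beta> (\<phi> w) (map (fd \<phi> w) vs)) z vs = local_d \<sigma> \<beta> (\<phi> z) (map (fd \<phi> z) vs)"
proof -
  have sm: "smooth_on S \<phi>" using \<phi> by (simp add: holomorphic_map_on_def)
  have ii: "fd \<phi> w (\<i> *s v) = \<i> *s fd \<phi> w v" if "w \<in> S" for w v
  proof -
    have "Vector_Spaces.linear (*s) (*s) (fd \<phi> w)" using \<phi> that by (simp add: holomorphic_map_on_def)
    then interpret Vector_Spaces.linear "(*s)" "(*s)" "fd \<phi> w" .
    show ?thesis by (rule scale)
  qed
  define H where "H a b = fd (\<lambda>w. fd \<phi> w b) z a" for a b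
  have H_commute: "H a b = H b a" for a b
    unfolding H_def by (rule fd_fd_commute[OF sm S])
  have H_ii: "H (\<i> *s a) b = \<i> *s H a b" for a b
  proof -
    have "H (\<i> *s a) b = fd (\<lambda>w. fd \<phi> w (\<i> *s a)) z b"
      using H_commute by (simp add: H_def)
    also have "\<dots> = fd (\<lambda>w. \<i> *s fd \<phi> w a) z b"
      using ii by (intro fun_cong[OF fd_cong_open[OF S]])
    also have "\<dots> = \<i> *s H b a"
      unfolding H_def
      by (rule fd_bounded_linear[OF bounded_linear_ii smooth_on_differentiable[OF smooth_on_fd[OF sm] S(2)]])
    finally show ?thesis using H_commute by simp
  qed
  define B where "B a b r = (\<beta> (\<phi> z) (H a b # map (fd \<phi> z) r) -
      \<sigma> * \<beta> (\<phi> z) (\<i> *s H a b # map (fd \<phi> z) r)) / 2" for a b r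
  have cderiv: "cderiv \<sigma> (\<lambda>w. \<beta> (\<phi> w) (map (fd \<phi> w) us)) z v =
      cderiv \<sigma> (\<lambda>x. \<beta> x (map (fd \<phi> z) us)) (\<phi> z) (fd \<phi> z v) +
      (\<Sum>k<length us. (-1) ^ k * B v (us ! k) (remove_nth k us))" for us v
  proof -
    have *: "fd (\<lambda>w. \<beta> (\<phi> w) (map (fd \<phi> w) us)) z h =
        fd (\<lambda>x. \<beta> x (map (fd \<phi> z) us)) (\<phi> z) (fd \<phi> z h) +
        (\<Sum>k<length us. (-1) ^ k * \<beta> (\<phi> z) (H h (us ! k) # map (fd \<phi> z) (remove_nth k us)))" for h
      using fd_eqI[OF has_derivative_pullback[OF T ST[OF S(2)] \<beta> S sm ST]] by (simp add: H_def map_remove_nth)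
    show ?thesis
      unfolding cderiv_def * H_ii B_def ii[OF S(2)]
      by (simp add: sum_distrib_left sum_subtractf sum_divide_distrib right_diff_distrib diff_divide_distrib
          distrib_left add_divide_distrib mult_ac)
  qed
  let ?X = "\<Sum>i<length vs. \<Sum>k<length vs - 1. (-1) ^ (i + k) *
      B (vs ! i) (remove_nth i vs ! k) (remove_nth k (remove_nth i vs))"
  have "local_d \<sigma> (\<lambda>w vs. \<beta> (\<phi> w) (map (fd \<phi> w) vs)) z vs = local_d \<sigma> \<beta> (\<phi> z) (map (fd \<phi> z) vs) + ?X"
    by (simp add: local_d_def cderiv distrib_left sum.distrib sum_distrib_left power_add mult.assoc
        flip: map_remove_nth)
  moreover have "?X = - ?X"
  proof -
    have "B a b r = B b a r" for a b r by (simp add: B_def H_commute[of a b])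
    then show ?thesis
      by (subst sum_remove_nth_swap[where F = B]) simp
  qed
  ultimately show ?thesis by simp
qed

lemma is_chart_overlap:
  assumes c: "is_chart X c" and d: "is_chart X d"
  shows "open (overlap c d)" and "z \<in> overlap c d \<Longrightarrow> z \<in> chart_image c"
    and "z \<in> overlap c d \<Longrightarrow> transition c d z \<in> chart_image d"
proof -
  have U: "openin X (fst c)" and V: "open (chart_image c)"
    and h: "homeomorphic_map (subtopology X (fst c)) (top_of_set (chart_image c)) (snd c)"
    using c by (auto simp: is_chart_def)
  have Ud: "openin X (fst d)" using d by (simp add: is_chart_def)
  have "openin (subtopology X (fst c)) (fst c \<inter> fst d)"
    using Ud by (auto simp: openin_subtopology)
  then have "openin (top_of_set (chart_image c)) (overlap c d)"
    using homeomorphic_imp_open_map[OF h] by (auto simp: overlap_def open_map_def)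
  then show "open (overlap c d)" using V by (rule openin_open_trans)
  show "z \<in> chart_image c" if "z \<in> overlap c d" using that by (auto simp: overlap_def)
  have "inj_on (snd c) (fst c)"
    using homeomorphic_imp_injective_map[OF h] openin_subset[OF U] by (simp add: Int_absorb1)
  then show "transition c d z \<in> chart_image d" if "z \<in> overlap c d"
    using that by (auto simp: overlap_def transition_def)
qed

lemma form_setD:
  assumes "\<omega> \<in> form_set A p q"
  shows "c \<in> A \<Longrightarrow> local_form p q (chart_image c) (\<omega> c)"
    and "c \<in> A \<Longrightarrow> d \<in> A \<Longrightarrow> z \<in> overlap c d \<Longrightarrow>
      \<omega> c z vs = \<omega> d (transition c d z) (map (fd (transition c d) z) vs)"
    and "c \<notin> A \<or> z \<notin> chart_image c \<Longrightarrow> \<omega> c z vs = 0"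
  using assms unfolding form_set_def by blast+

lemma form_setI:
  assumes "\<And>c. c \<in> A \<Longrightarrow> local_form p q (chart_image c) (\<omega> c)"
    and "\<And>c d z vs. c \<in> A \<Longrightarrow> d \<in> A \<Longrightarrow> z \<in> overlap c d \<Longrightarrow>
      \<omega> c z vs = \<omega> d (transition c d z) (map (fd (transition c d) z) vs)"
    and "\<And>c z vs. c \<notin> A \<or> z \<notin> chart_image c \<Longrightarrow> \<omega> c z vs = 0"
  shows "\<omega> \<in> form_set A p q"
  unfolding form_set_def using assms by blast

definition form_d :: "('a, 'n::finite) chart set \<Rightarrow> complex \<Rightarrow> ('a, 'n) form \<Rightarrow> ('a, 'n) form" where
  "form_d A \<sigma> \<omega> = (\<lambda>c z vs. if c \<in> A \<and> z \<in> chart_image c then local_d \<sigma> (\<omega> c) z vs else 0)"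

context
  fixes X :: "'a topology" and A :: "('a, 'n::finite) chart set"
  assumes manifold: "compact_complex_manifold X A"
begin

lemma chart: "c \<in> A \<Longrightarrow> is_chart X c"
  using manifold by (simp add: compact_complex_manifold_def)

lemma open_chart_image: "c \<in> A \<Longrightarrow> open (chart_image c)"
  using chart by (simp add: is_chart_def)

lemma form_smooth: "\<omega> \<in> form_set A p q \<Longrightarrow> c \<in> A \<Longrightarrow> smooth_on (chart_image c) (\<lambda>z. \<omega> c z vs)"
  by (rule local_form_smooth[OF open_chart_image form_setD(1)])

lemma form_differentiable:
  "\<omega> \<in> form_set A p q \<Longrightarrow> c \<in> A \<Longrightarrow> z \<in> chart_image c \<Longrightarrow> (\<lambda>z. \<omega> c z vs) differentiable (at z)"
  by (rule smooth_on_differentiable[OF form_smooth])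

lemma del_eq: "\<omega> \<in> form_set A p q \<Longrightarrow> del A \<omega> = form_d A \<i> \<omega>"
  by (auto simp: del_def form_d_def fun_eq_iff intro!: local_del_eq form_differentiable)

lemma delbar_eq: "\<omega> \<in> form_set A p q \<Longrightarrow> delbar A \<omega> = form_d A (- \<i>) \<omega>"
  by (auto simp: delbar_def form_d_def fun_eq_iff intro!: local_delbar_eq form_differentiable)

lemma form_d_in_form_set:
  assumes \<omega>: "\<omega> \<in> form_set A p q"
    and loc: "\<And>c. c \<in> A \<Longrightarrow> local_form p' q' (chart_image c) (local_d \<sigma> (\<omega> c))"
  shows "form_d A \<sigma> \<omega> \<in> form_set A p' q'"
proof (rule form_setI)
  show "local_form p' q' (chart_image c) (form_d A \<sigma> \<omega> c)" if "c \<in> A" for c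
    using loc[OF that] that by (simp add: local_form_def form_d_def)
  show "form_d A \<sigma> \<omega> c z vs = form_d A \<sigma> \<omega> d (transition c d z) (map (fd (transition c d) z) vs)"
    if "c \<in> A" "d \<in> A" "z \<in> overlap c d" for c d z vs
  proof -
    note ov = is_chart_overlap[OF chart[OF that(1)] chart[OF that(2)]]
    have hol: "holomorphic_map_on (overlap c d) (transition c d)"
      using manifold that by (simp add: compact_complex_manifold_def)
    have "local_d \<sigma> (\<omega> c) z vs = local_d \<sigma> (\<lambda>w vs. \<omega> d (transition c d w) (map (fd (transition c d) w) vs)) z vs"
      by (rule local_d_cong[OF ov(1) that(3)]) (rule form_setD(2)[OF \<omega> that(1,2)])
    also have "\<dots> = local_d \<sigma> (\<omega> d) (transition c d z) (map (fd (transition c d) z) vs)"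
      by (rule local_d_pullback[OF open_chart_image[OF that(2)] form_setD(1)[OF \<omega> that(2)] ov(1) that(3) hol ov(3)])
    finally show ?thesis
      using that ov(2,3)[OF that(3)] by (simp add: form_d_def)
  qed
qed (auto simp: form_d_def)

lemma del_in_form_set: "\<omega> \<in> form_set A p q \<Longrightarrow> del A \<omega> \<in> form_set A (Suc p) q"
  by (subst del_eq, assumption)
    (intro form_d_in_form_set local_form_local_del open_chart_image form_setD(1))

lemma delbar_in_form_set: "\<omega> \<in> form_set A p q \<Longrightarrow> delbar A \<omega> \<in> form_set A p (Suc q)"
  by (subst delbar_eq, assumption)
    (intro form_d_in_form_set local_form_local_delbar open_chart_image form_setD(1))

lemma form_d_anticommute:
  assumes \<omega>: "\<omega> \<in> form_set A p q"
  shows "form_d A \<sigma> (form_d A \<tau> \<omega>) c z vs = - form_d A \<tau> (form_d A \<sigma> \<omega>) c z vs"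
proof -
  have eq: "local_d \<sigma> (form_d A \<tau> \<omega> c) z vs = local_d \<sigma> (local_d \<tau> (\<omega> c)) z vs"
    if "c \<in> A" "z \<in> chart_image c" for \<sigma> \<tau>
    by (rule local_d_cong[OF open_chart_image[OF that(1)] that(2)]) (use that in \<open>simp add: form_d_def\<close>)
  show ?thesis
  proof (cases "c \<in> A \<and> z \<in> chart_image c")
    case True
    then have c: "c \<in> A" and z: "z \<in> chart_image c" by auto
    have "local_d \<sigma> (local_d \<tau> (\<omega> c)) z vs = - local_d \<tau> (local_d \<sigma> (\<omega> c)) z vs"
      by (rule local_d_anticommute[OF open_chart_image[OF c] z form_smooth[OF \<omega> c]])
    then show ?thesis
      using c z by (simp add: form_d_def[of A _ "form_d A _ _"] eq)
  qed (auto simp: form_d_def)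
qed

lemma form_d_add:
  assumes "\<omega> \<in> form_set A p q" "\<eta> \<in> form_set A p q"
  shows "form_d A \<sigma> (\<lambda>c z vs. \<omega> c z vs + \<eta> c z vs) c z vs = form_d A \<sigma> \<omega> c z vs + form_d A \<sigma> \<eta> c z vs"
  using assms[THEN form_differentiable]
  by (simp add: form_d_def local_d_def cderiv_add distrib_left sum.distrib)

lemma form_d_scale:
  assumes "\<omega> \<in> form_set A p q"
  shows "form_d A \<sigma> (\<lambda>c z vs. a * \<omega> c z vs) c z vs = a * form_d A \<sigma> \<omega> c z vs"
  using assms[THEN form_differentiable]
  by (simp add: form_d_def local_d_def cderiv_cmult sum_distrib_left mult_ac)

lemma form_set_add:
  assumes \<omega>: "\<omega> \<in> form_set A p q" and \<eta>: "\<eta> \<in> form_set A p q"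
  shows "(\<lambda>c z vs. \<omega> c z vs + \<eta> c z vs) \<in> form_set A p q"
proof (rule form_setI)
  show "\<omega> c z vs + \<eta> c z vs = \<omega> d (transition c d z) (map (fd (transition c d) z) vs) +
      \<eta> d (transition c d z) (map (fd (transition c d) z) vs)"
    if "c \<in> A" "d \<in> A" "z \<in> overlap c d" for c d z vs
    using form_setD(2)[OF \<omega> that, of vs] form_setD(2)[OF \<eta> that, of vs] by (rule arg_cong2)
  show "\<omega> c z vs + \<eta> c z vs = 0" if "c \<notin> A \<or> z \<notin> chart_image c" for c z vs
    using form_setD(3)[OF \<omega> that] form_setD(3)[OF \<eta> that] by simp
qed (rule local_form_add[OF open_chart_image form_setD(1)[OF \<omega>] form_setD(1)[OF \<eta>]])

lemma form_set_scale:
  assumes \<omega>: "\<omega> \<in> form_set A p q"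
  shows "(\<lambda>c z vs. a * \<omega> c z vs) \<in> form_set A p q"
proof (rule form_setI)
  show "a * \<omega> c z vs = a * \<omega> d (transition c d z) (map (fd (transition c d) z) vs)"
    if "c \<in> A" "d \<in> A" "z \<in> overlap c d" for c d z vs
    using form_setD(2)[OF \<omega> that, of vs] by (rule arg_cong)
  show "a * \<omega> c z vs = 0" if "c \<notin> A \<or> z \<notin> chart_image c" for c z vs
    using form_setD(3)[OF \<omega> that] by simp
qed (rule local_form_scale[OF open_chart_image form_setD(1)[OF \<omega>]])

lemma zero_form_in_form_set: "zero_form \<in> form_set A p q"
  by (auto simp: form_set_def zero_form_def local_form_def intro!: exI[of _ "\<lambda>_ _ _. 0"] smooth_on_zero)

end

section \<open>The cohomology spaces\<close>

context vector_space
begin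

lemma subspace_image_on:
  assumes U: "subspace U" and add: "\<And>x y. x \<in> U \<Longrightarrow> y \<in> U \<Longrightarrow> h (x + y) = h x + h y"
    and scale: "\<And>a x. x \<in> U \<Longrightarrow> h (scale a x) = scale a (h x)"
  shows "subspace (h ` U)"
proof (rule subspaceI)
  have "h 0 = 0" using scale[OF subspace_0[OF U], of 0] by simp
  then show "0 \<in> h ` U" using subspace_0[OF U] by force
  show "x + y \<in> h ` U" if "x \<in> h ` U" "y \<in> h ` U" for x y
    using that subspace_add[OF U] by (auto simp flip: add)
  show "scale a x \<in> h ` U" if "x \<in> h ` U" for a x
    using that subspace_scale[OF U] by (auto simp flip: scale)
qed

lemma subspace_vimage_on:
  assumes U: "subspace U" and W: "subspace W"
    and add: "\<And>x y. x \<in> U \<Longrightarrow> y \<in> U \<Longrightarrow> h (x + y) = h x + h y"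
    and scale: "\<And>a x. x \<in> U \<Longrightarrow> h (scale a x) = scale a (h x)"
  shows "subspace {x \<in> U. h x \<in> W}"
proof (rule subspaceI)
  have "h 0 = 0" using scale[OF subspace_0[OF U], of 0] by simp
  then show "0 \<in> {x \<in> U. h x \<in> W}" using subspace_0[OF U] subspace_0[OF W] by simp
qed (auto simp: add scale subspace_add[OF U] subspace_add[OF W] subspace_scale[OF U] subspace_scale[OF W])

lemma coset_eq_iff:
  assumes W: "subspace W"
  shows "(\<lambda>w. w + x) ` W = (\<lambda>w. w + y) ` W \<longleftrightarrow> x - y \<in> W"
proof
  assume "(\<lambda>w. w + x) ` W = (\<lambda>w. w + y) ` W"
  moreover have "x \<in> (\<lambda>w. w + x) ` W" using subspace_0[OF W] by force
  ultimately show "x - y \<in> W" by auto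
next
  assume xy: "x - y \<in> W"
  have "w + x \<in> (\<lambda>w. w + y) ` W" if "w \<in> W" for w
    using subspace_add[OF W that xy] by (rule rev_image_eqI) simp
  moreover have "w + y \<in> (\<lambda>w. w + x) ` W" if "w \<in> W" for w
    using subspace_diff[OF W that xy] by (rule rev_image_eqI) simp
  ultimately show "(\<lambda>w. w + x) ` W = (\<lambda>w. w + y) ` W" by blast
qed

end

lemma Collect_image_eq: "(\<And>x. x \<in> S \<Longrightarrow> P (f x) \<longleftrightarrow> Q x) \<Longrightarrow> {y \<in> f ` S. P y} = f ` {x \<in> S. Q x}"
  by auto

definition form_scale :: "complex \<Rightarrow> ('a, 'n::finite) form \<Rightarrow> ('a, 'n) form" where
  "form_scale a \<omega> = (\<lambda>c z vs. a * \<omega> c z vs)"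

interpretation form: vector_space form_scale
  by standard (simp_all add: form_scale_def fun_eq_iff algebra_simps)

lemma zero_form_eq: "zero_form = 0"
  by (simp add: zero_form_def fun_eq_iff)

lemma add_forms: "x \<oplus>\<^bsub>forms A p q\<^esub> y = x + y"
  by (simp add: forms_def fun_eq_iff)

lemma smult_forms: "a \<odot>\<^bsub>forms A p q\<^esub> x = form_scale a x"
  by (simp add: forms_def form_scale_def)

lemma coset_forms: "W +>\<^bsub>forms A p q\<^esub> x = (\<lambda>w. w + x) ` W"
  by (simp add: a_r_coset_eq add_forms)

lemma set_add_forms: "U <+>\<^bsub>forms A p q\<^esub> W = {u + w | u w. u \<in> U \<and> w \<in> W}"
  by (auto simp: set_add_def' add_forms)

lemma induced_map_coset:
  assumes W: "form.subspace W" and W': "form.subspace W'"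
    and f: "\<And>w. w \<in> W \<Longrightarrow> f (w + x) - f x \<in> W'"
  shows "induced_map (forms A p q) W' f ((\<lambda>w. w + x) ` W) = (\<lambda>w. w + f x) ` W'"
proof -
  have "(\<lambda>v. v + f (w + x)) ` W' = (\<lambda>v. v + f x) ` W'" if "w \<in> W" for w
    using f[OF that] by (simp add: form.coset_eq_iff[OF W'])
  then show ?thesis
    using form.subspace_0[OF W] by (auto simp: induced_map_def coset_forms)
qed

lemma zero_H_delbar: "\<zero>\<^bsub>H_delbar A p q\<^esub> = im_delbar A p q"
  by (simp add: H_delbar_def quotient_space_def)

lemma carrier_forms_quotient:
  "carrier (quotient_space (subspace_of (forms A p q) Z) W) = (\<lambda>x. (\<lambda>w. w + x) ` W) ` Z"
  by (auto simp: quotient_space_def subspace_of_def A_RCOSETS_def' a_r_coset_eq forms_def plus_fun_def)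

context
  fixes X :: "'a topology" and A :: "('a, 'n::finite) chart set"
  assumes manifold: "compact_complex_manifold X A"
begin

lemma subspace_form_set: "form.subspace (form_set A p q)"
proof (rule form.subspaceI)
  show "0 \<in> form_set A p q"
    using zero_form_in_form_set[OF manifold] by (simp add: zero_form_eq)
  show "x + y \<in> form_set A p q" if "x \<in> form_set A p q" "y \<in> form_set A p q" for x y
    using form_set_add[OF manifold that] by (simp add: plus_fun_def)
  show "form_scale a x \<in> form_set A p q" if "x \<in> form_set A p q" for a x
    using form_set_scale[OF manifold that] by (simp add: form_scale_def)
qed

lemma carrier_forms: "carrier (forms A p q) = (if 0 \<le> p \<and> 0 \<le> q then form_set A (nat p) (nat q) else {0})"
  by (simp add: forms_def zero_form_eq)

lemma subspace_forms: "form.subspace (carrier (forms A p q))"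
  by (simp add: carrier_forms subspace_form_set form.subspace_single_0)

lemma forms_subset_form_set: "carrier (forms A p q) \<subseteq> form_set A (nat p) (nat q)"
  using form.subspace_0[OF subspace_form_set] by (simp add: carrier_forms)

lemma del_zero: "del A 0 = 0" and delbar_zero: "delbar A 0 = 0"
  by (simp_all add: fun_eq_iff del_def delbar_def local_del_def local_delbar_def deriv_z_def deriv_zbar_def)

lemma del_mem: "x \<in> carrier (forms A p q) \<Longrightarrow> del A x \<in> carrier (forms A (p + 1) q)"
  using del_in_form_set[OF manifold, of x "nat p" "nat q"] form.subspace_0[OF subspace_form_set]
  by (auto simp: carrier_forms del_zero nat_add_distrib split: if_splits)

lemma delbar_mem: "x \<in> carrier (forms A p q) \<Longrightarrow> delbar A x \<in> carrier (forms A p (q + 1))"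
  using delbar_in_form_set[OF manifold, of x "nat p" "nat q"] form.subspace_0[OF subspace_form_set]
  by (auto simp: carrier_forms delbar_zero nat_add_distrib split: if_splits)

lemma
  assumes "x \<in> carrier (forms A p q)" "y \<in> carrier (forms A p q)"
  shows del_add: "del A (x + y) = del A x + del A y"
    and delbar_add: "delbar A (x + y) = delbar A x + delbar A y"
proof -
  have xy: "x \<in> form_set A (nat p) (nat q)" "y \<in> form_set A (nat p) (nat q)"
    using assms forms_subset_form_set by blast+
  have "x + y \<in> form_set A (nat p) (nat q)" using form.subspace_add[OF subspace_form_set xy] .
  note eq = this xy
  have "form_d A \<sigma> (x + y) = form_d A \<sigma> x + form_d A \<sigma> y" for \<sigma>
    using form_d_add[OF manifold xy] by (simp add: fun_eq_iff plus_fun_def)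
  then show "del A (x + y) = del A x + del A y" "delbar A (x + y) = delbar A x + delbar A y"
    by (simp_all add: eq[THEN del_eq[OF manifold]] eq[THEN delbar_eq[OF manifold]])
qed

lemma
  assumes "x \<in> carrier (forms A p q)"
  shows del_scale: "del A (form_scale a x) = form_scale a (del A x)"
    and delbar_scale: "delbar A (form_scale a x) = form_scale a (delbar A x)"
proof -
  have x: "x \<in> form_set A (nat p) (nat q)" using assms forms_subset_form_set by blast
  have "form_scale a x \<in> form_set A (nat p) (nat q)" using form.subspace_scale[OF subspace_form_set x] .
  note eq = this x
  have "form_d A \<sigma> (form_scale a x) = form_scale a (form_d A \<sigma> x)" for \<sigma>
    using form_d_scale[OF manifold x] by (simp add: fun_eq_iff form_scale_def)
  then show "del A (form_scale a x) = form_scale a (del A x)" "delbar A (form_scale a x) = form_scale a (delbar A x)"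
    by (simp_all add: eq[THEN del_eq[OF manifold]] eq[THEN delbar_eq[OF manifold]])
qed

lemma
  assumes "x \<in> carrier (forms A p q)"
  shows del_del: "del A (del A x) = 0"
    and delbar_delbar: "delbar A (delbar A x) = 0"
    and del_delbar: "del A (delbar A x) = - delbar A (del A x)"
proof -
  have x: "x \<in> form_set A (nat p) (nat q)" using assms forms_subset_form_set by blast
  note d = del_in_form_set[OF manifold x] delbar_in_form_set[OF manifold x]
  have eq: "del A x = form_d A \<i> x" "delbar A x = form_d A (- \<i>) x"
    "del A (del A x) = form_d A \<i> (del A x)" "delbar A (delbar A x) = form_d A (- \<i>) (delbar A x)"
    "del A (delbar A x) = form_d A \<i> (delbar A x)" "delbar A (del A x) = form_d A (- \<i>) (del A x)"
    by (fact del_eq[OF manifold x] delbar_eq[OF manifold x] del_eq[OF manifold d(1)]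
        delbar_eq[OF manifold d(2)] del_eq[OF manifold d(2)] delbar_eq[OF manifold d(1)])+
  have anti: "form_d A \<sigma> (form_d A \<tau> x) = - form_d A \<tau> (form_d A \<sigma> x)" for \<sigma> \<tau>
    by (intro ext) (simp only: uminus_apply, rule form_d_anticommute[OF manifold x])
  have zero: "form_d A \<sigma> (form_d A \<sigma> x) = 0" for \<sigma>
  proof -
    have *: "y = 0" if "y = - y" for y :: "('a, 'n) form"
    proof (intro ext)
      show "y c z vs = 0 c z vs" for c z vs
        using fun_cong[OF fun_cong[OF fun_cong[OF that, of c], of z], of vs] by simp
    qed
    show ?thesis by (rule *) (rule anti)
  qed
  show "del A (del A x) = 0" "delbar A (delbar A x) = 0"
    unfolding eq(3,4) unfolding eq(1,2) by (rule zero)+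
  show "del A (delbar A x) = - delbar A (del A x)" 
    unfolding eq(5,6) unfolding eq(1,2) by (rule anti)
qed

lemma presents_forms_quotient:
  assumes Z: "form.subspace Z" "Z \<subseteq> carrier (forms A p q)" and W: "form.subspace W" "W \<subseteq> Z"
  shows "presents form_scale Z W (\<lambda>x. (\<lambda>w. w + x) ` W) (quotient_space (subspace_of (forms A p q) Z) W)"
proof -
  have "presents form_scale (carrier (forms A p q)) {0} (\<lambda>x. x) (forms A p q)"
    by (simp add: presents_def add_forms smult_forms)
  from form.presents_quotient_space[OF subspace_forms W(1) _ Z this] W(2) Z(2)
  have "presents form_scale Z {x \<in> Z. \<exists>t\<in>W. x - t \<in> {0}} (\<lambda>x. (\<lambda>w. w + x) ` W)
      (quotient_space (subspace_of (forms A p q) Z) W)"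
    by (simp add: coset_forms)
  also have "{x \<in> Z. \<exists>t\<in>W. x - t \<in> {0}} = W" using W(2) by auto
  finally show ?thesis .
qed

lemma im_del_subset: "im_del A p q \<subseteq> carrier (forms A p q)"
  using del_mem[of _ "p - 1" q] by (auto simp: im_del_def)

lemma im_delbar_subset: "im_delbar A p q \<subseteq> carrier (forms A p q)"
  using delbar_mem[of _ p "q - 1"] by (auto simp: im_delbar_def)

lemma subspace_im_del: "form.subspace (im_del A p q)"
  unfolding im_del_def by (rule form.subspace_image_on[OF subspace_forms del_add del_scale])

lemma subspace_im_delbar: "form.subspace (im_delbar A p q)"
  unfolding im_delbar_def by (rule form.subspace_image_on[OF subspace_forms delbar_add delbar_scale])

lemma ker_del_eq: "ker_del A p q = {x \<in> carrier (forms A p q). del A x \<in> {0}}"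
  and ker_delbar_eq: "ker_delbar A p q = {x \<in> carrier (forms A p q). delbar A x \<in> {0}}"
  and ker_del_delbar_eq: "ker_del_delbar A p q = {x \<in> carrier (forms A p q). del A (delbar A x) \<in> {0}}"
  by (simp_all add: ker_del_def ker_delbar_def ker_del_delbar_def zero_form_eq)

lemma subspace_ker_del: "form.subspace (ker_del A p q)"
  unfolding ker_del_eq
  by (rule form.subspace_vimage_on[OF subspace_forms form.subspace_single_0 del_add del_scale])

lemma subspace_ker_delbar: "form.subspace (ker_delbar A p q)"
  unfolding ker_delbar_eq
  by (rule form.subspace_vimage_on[OF subspace_forms form.subspace_single_0 delbar_add delbar_scale])

lemma subspace_ker_del_delbar: "form.subspace (ker_del_delbar A p q)"
  unfolding ker_del_delbar_eq
  by (rule form.subspace_vimage_on[OF subspace_forms form.subspace_single_0])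
    (simp_all add: delbar_add delbar_scale del_add[OF delbar_mem delbar_mem] del_scale[OF delbar_mem])

lemma ker_del_subset: "ker_del A p q \<subseteq> carrier (forms A p q)"
  and ker_delbar_subset: "ker_delbar A p q \<subseteq> carrier (forms A p q)"
  and ker_del_delbar_subset: "ker_del_delbar A p q \<subseteq> carrier (forms A p q)"
  by (auto simp: ker_del_eq ker_delbar_eq ker_del_delbar_eq)

lemma im_del_subset_ker_del: "im_del A p q \<subseteq> ker_del A p q"
  using im_del_subset by (auto simp: im_del_def ker_del_eq del_del)

lemma im_delbar_subset_ker_delbar: "im_delbar A p q \<subseteq> ker_delbar A p q"
  using im_delbar_subset by (auto simp: im_delbar_def ker_delbar_eq delbar_delbar)

lemma ker_delbar_subset_ker_del_delbar: "ker_delbar A p q \<subseteq> ker_del_delbar A p q"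
  by (auto simp: ker_delbar_eq ker_del_delbar_eq del_zero)

lemma ker_del_subset_ker_del_delbar: "ker_del A p q \<subseteq> ker_del_delbar A p q"
  by (auto simp: ker_del_eq ker_del_delbar_eq del_delbar delbar_zero)

lemma aeppli_im_eq: "aeppli_im A p q = {u + w | u w. u \<in> im_del A p q \<and> w \<in> im_delbar A p q}"
  by (simp add: aeppli_im_def set_add_forms)

lemma subspace_aeppli_im: "form.subspace (aeppli_im A p q)"
  unfolding aeppli_im_eq by (rule form.subspace_sums[OF subspace_im_del subspace_im_delbar])

lemma im_delbar_subset_aeppli_im: "im_delbar A p q \<subseteq> aeppli_im A p q"
  unfolding aeppli_im_eq using form.subspace_0[OF subspace_im_del] by force

lemma im_del_subset_aeppli_im: "im_del A p q \<subseteq> aeppli_im A p q"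
proof
  fix x assume "x \<in> im_del A p q"
  then have "x + 0 \<in> aeppli_im A p q"
    unfolding aeppli_im_eq using form.subspace_0[OF subspace_im_delbar] by blast
  then show "x \<in> aeppli_im A p q" by simp
qed

lemma aeppli_im_subset: "aeppli_im A p q \<subseteq> ker_del_delbar A p q"
  unfolding aeppli_im_eq
  using im_del_subset_ker_del ker_del_subset_ker_del_delbar im_delbar_subset_ker_delbar
    ker_delbar_subset_ker_del_delbar form.subspace_add[OF subspace_ker_del_delbar]
  by blast

lemma del_aeppli_im:
  assumes "x \<in> aeppli_im A p q"
  shows "del A x \<in> im_delbar A (p + 1) q"
proof -
  obtain a b where ab: "a \<in> carrier (forms A (p - 1) q)" "b \<in> carrier (forms A p (q - 1))"
    and x: "x = del A a + delbar A b"
    using assms by (auto simp: aeppli_im_eq im_del_def im_delbar_def)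
  have "del A a \<in> carrier (forms A p q)" "delbar A b \<in> carrier (forms A p q)"
    using del_mem[OF ab(1)] delbar_mem[OF ab(2)] by simp_all
  then have "del A x = - delbar A (del A b)"
    using ab by (simp add: x del_add del_del del_delbar)
  moreover have "delbar A (del A b) \<in> im_delbar A (p + 1) q"
    using del_mem[OF ab(2)] by (simp add: im_delbar_def)
  ultimately show ?thesis using form.subspace_neg[OF subspace_im_delbar] by simp
qed

abbreviation dolbeault_class :: "int \<Rightarrow> int \<Rightarrow> ('a, 'n) form \<Rightarrow> ('a, 'n) form set" where
  "dolbeault_class p q x \<equiv> (\<lambda>w. w + x) ` im_delbar A p q"

abbreviation aeppli_class :: "int \<Rightarrow> int \<Rightarrow> ('a, 'n) form \<Rightarrow> ('a, 'n) form set" where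
  "aeppli_class p q x \<equiv> (\<lambda>w. w + x) ` aeppli_im A p q"

lemma presents_H_delbar:
  "presents form_scale (ker_delbar A p q) (im_delbar A p q) (dolbeault_class p q) (H_delbar A p q)"
  unfolding H_delbar_def
  by (rule presents_forms_quotient[OF subspace_ker_delbar ker_delbar_subset subspace_im_delbar
        im_delbar_subset_ker_delbar])

lemma presents_H_A:
  "presents form_scale (ker_del_delbar A p q) (aeppli_im A p q) (aeppli_class p q) (H_A A p q)"
  unfolding H_A_def
  by (rule presents_forms_quotient[OF subspace_ker_del_delbar ker_del_delbar_subset subspace_aeppli_im
        aeppli_im_subset])

lemma del_class_dolbeault:
  assumes "x \<in> ker_delbar A p q"
  shows "del_class A p q (dolbeault_class p q x) = dolbeault_class (p + 1) q (del A x)"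
  unfolding del_class_def
proof (rule induced_map_coset[OF subspace_im_delbar subspace_im_delbar])
  fix w assume w: "w \<in> im_delbar A p q"
  show "del A (w + x) - del A x \<in> im_delbar A (p + 1) q"
    using del_aeppli_im[OF subsetD[OF im_delbar_subset_aeppli_im w]]
    by (simp add: del_add[OF subsetD[OF im_delbar_subset w] subsetD[OF ker_delbar_subset assms]])
qed

lemma del_class_aeppli:
  assumes "x \<in> ker_del_delbar A p q"
  shows "del_class A p q (aeppli_class p q x) = dolbeault_class (p + 1) q (del A x)"
  unfolding del_class_def
proof (rule induced_map_coset[OF subspace_aeppli_im subspace_im_delbar])
  fix w assume w: "w \<in> aeppli_im A p q"
  have "w \<in> carrier (forms A p q)" "x \<in> carrier (forms A p q)"
    using w assms aeppli_im_subset ker_del_delbar_subset by blast+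
  then show "del A (w + x) - del A x \<in> im_delbar A (p + 1) q"
    using del_aeppli_im[OF w] by (simp add: del_add)
qed

lemma dolbeault_class_eq_zero_iff: "dolbeault_class p q x = im_delbar A p q \<longleftrightarrow> x \<in> im_delbar A p q"
  using form.coset_eq_iff[OF subspace_im_delbar, of x _ _ 0] by simp

lemma del_class_dolbeault_eq_zero_iff:
  "x \<in> ker_delbar A p q \<Longrightarrow>
    del_class A p q (dolbeault_class p q x) = im_delbar A (p + 1) q \<longleftrightarrow> del A x \<in> im_delbar A (p + 1) q"
  by (simp only: del_class_dolbeault dolbeault_class_eq_zero_iff)

lemma del_class_aeppli_eq_zero_iff:
  "x \<in> ker_del_delbar A p q \<Longrightarrow>
    del_class A p q (aeppli_class p q x) = im_delbar A (p + 1) q \<longleftrightarrow> del A x \<in> im_delbar A (p + 1) q"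
  by (simp only: del_class_aeppli dolbeault_class_eq_zero_iff)

definition ker_del_class :: "int \<Rightarrow> int \<Rightarrow> ('a, 'n) form set" where
  "ker_del_class p q = {x \<in> ker_delbar A p q. del A x \<in> im_delbar A (p + 1) q}"

definition calG_forms :: "int \<Rightarrow> int \<Rightarrow> ('a, 'n) form set" where
  "calG_forms p q = {x \<in> ker_del_delbar A p q. del A x \<in> im_delbar A (p + 1) q}"

definition closed_forms :: "int \<Rightarrow> int \<Rightarrow> ('a, 'n) form set" where
  "closed_forms p q = ker_del A p q \<inter> ker_delbar A p q"

definition closed_mod :: "int \<Rightarrow> int \<Rightarrow> ('a, 'n) form set" where
  "closed_mod p q = {x + w | x w. x \<in> closed_forms p q \<and> w \<in> im_delbar A p q}"

definition exact_mod :: "int \<Rightarrow> int \<Rightarrow> ('a, 'n) form set" where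
  "exact_mod p q = {x + w | x w. x \<in> im_del A p q \<inter> ker_delbar A p q \<and> w \<in> im_delbar A p q}"

lemma subspace_ker_del_class: "form.subspace (ker_del_class p q)"
  unfolding ker_del_class_def
  by (rule form.subspace_vimage_on[OF subspace_ker_delbar subspace_im_delbar])
    (use ker_delbar_subset in \<open>auto intro!: del_add del_scale\<close>)

lemma subspace_closed_forms: "form.subspace (closed_forms p q)"
  unfolding closed_forms_def by (rule form.subspace_inter[OF subspace_ker_del subspace_ker_delbar])

lemma subspace_closed_mod: "form.subspace (closed_mod p q)"
  unfolding closed_mod_def by (rule form.subspace_sums[OF subspace_closed_forms subspace_im_delbar])

lemma subspace_exact_mod: "form.subspace (exact_mod p q)"
  unfolding exact_mod_def
  by (rule form.subspace_sums[OF form.subspace_inter[OF subspace_im_del subspace_ker_delbar] subspace_im_delbar])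

lemma im_delbar_subset_ker_del_class: "im_delbar A p q \<subseteq> ker_del_class p q"
  using subsetD[OF im_delbar_subset_ker_delbar] del_aeppli_im[OF subsetD[OF im_delbar_subset_aeppli_im]]
  by (simp add: ker_del_class_def subset_iff)

lemma closed_forms_subset_ker_del_class: "closed_forms p q \<subseteq> ker_del_class p q"
  using form.subspace_0[OF subspace_im_delbar]
  by (auto simp: closed_forms_def ker_del_class_def ker_del_eq)

lemma closed_mod_subset: "closed_mod p q \<subseteq> ker_del_class p q"
  unfolding closed_mod_def
  using im_delbar_subset_ker_del_class closed_forms_subset_ker_del_class
    form.subspace_add[OF subspace_ker_del_class] by blast

lemma exact_mod_subset: "exact_mod p q \<subseteq> closed_mod p q"
  unfolding exact_mod_def closed_mod_def closed_forms_def using im_del_subset_ker_del by blast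

lemma im_delbar_subset_exact_mod: "im_delbar A p q \<subseteq> exact_mod p q"
  unfolding exact_mod_def
  using form.subspace_0[OF form.subspace_inter[OF subspace_im_del subspace_ker_delbar]] by force

lemma presents_ker_del_H_delbar:
  "presents form_scale (ker_del_class p q) (im_delbar A p q) (dolbeault_class p q) (ker_del_H_delbar A p q)"
proof -
  have "{C \<in> carrier (H_delbar A p q). del_class A p q C = \<zero>\<^bsub>H_delbar A (p + 1) q\<^esub>} =
      dolbeault_class p q ` ker_del_class p q"
    unfolding presentsD(1)[OF presents_H_delbar, symmetric] zero_H_delbar
    unfolding ker_del_class_def by (rule Collect_image_eq) (rule del_class_dolbeault_eq_zero_iff)
  then show ?thesis
    using presents_subspace_of[OF presents_H_delbar, of "ker_del_class p q" p q]
    by (auto simp: ker_del_H_delbar_def ker_del_class_def)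
qed

lemma calG_del_eq: "calG_del A p q = aeppli_class p q ` calG_forms p q"
  unfolding calG_del_def presentsD(1)[OF presents_H_A, symmetric] zero_H_delbar
  unfolding calG_forms_def by (rule Collect_image_eq) (rule del_class_aeppli_eq_zero_iff)

lemma aeppli_class_eq_iff: "aeppli_class p q x = aeppli_class p q y \<longleftrightarrow> x - y \<in> aeppli_im A p q"
  by (rule form.coset_eq_iff[OF subspace_aeppli_im])

lemma to_H_A_coset:
  assumes "form.subspace W" "W \<subseteq> aeppli_im A p q"
  shows "to_H_A A p q ((\<lambda>w. w + x) ` W) = aeppli_class p q x"
  unfolding to_H_A_def
  by (subst induced_map_coset[OF assms(1) subspace_aeppli_im]) (use assms(2) in auto)

lemma calH_delbar_eq: "calH_delbar A p q = aeppli_class p q ` ker_delbar A p q"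
  unfolding calH_delbar_def presentsD(1)[OF presents_H_delbar, symmetric] image_image
  by (simp add: to_H_A_coset[OF subspace_im_delbar im_delbar_subset_aeppli_im])

lemma calH_del_eq: "calH_del A p q = aeppli_class p q ` ker_del A p q"
  unfolding calH_del_def H_del_def carrier_forms_quotient image_image
  by (simp add: to_H_A_coset[OF subspace_im_del im_del_subset_aeppli_im])

lemma calH_delbar_inter_calG_del:
  "calH_delbar A p q \<inter> calG_del A p q = aeppli_class p q ` ker_del_class p q"
proof (intro equalityI subsetI)
  fix C assume "C \<in> calH_delbar A p q \<inter> calG_del A p q"
  then obtain x y where xy: "x \<in> ker_delbar A p q" "C = aeppli_class p q x"
    "y \<in> calG_forms p q" "C = aeppli_class p q y"
    unfolding calH_delbar_eq calG_del_eq by blast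
  then have "x - y \<in> aeppli_im A p q" using aeppli_class_eq_iff by metis
  then have diff: "x - y \<in> carrier (forms A p q)" "del A (x - y) \<in> im_delbar A (p + 1) q"
    using aeppli_im_subset ker_del_delbar_subset del_aeppli_im by blast+
  have y: "y \<in> carrier (forms A p q)" "del A y \<in> im_delbar A (p + 1) q"
    using xy(3) ker_del_delbar_subset by (auto simp: calG_forms_def)
  have "del A x = del A (x - y) + del A y" using del_add[OF diff(1) y(1)] by simp
  then have "del A x \<in> im_delbar A (p + 1) q"
    using form.subspace_add[OF subspace_im_delbar diff(2) y(2)] by simp
  then show "C \<in> aeppli_class p q ` ker_del_class p q"
    using xy(1,2) by (simp add: ker_del_class_def)
next
  fix C assume "C \<in> aeppli_class p q ` ker_del_class p q"
  then show "C \<in> calH_delbar A p q \<inter> calG_del A p q"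
    unfolding calH_delbar_eq calG_del_eq ker_del_class_def calG_forms_def
    using ker_delbar_subset_ker_del_delbar by blast
qed

lemma calH_delbar_inter_calH_del:
  "calH_delbar A p q \<inter> calH_del A p q = aeppli_class p q ` closed_forms p q"
proof (intro equalityI subsetI)
  fix C assume "C \<in> calH_delbar A p q \<inter> calH_del A p q"
  then obtain x y where xy: "x \<in> ker_delbar A p q" "C = aeppli_class p q x"
    "y \<in> ker_del A p q" "C = aeppli_class p q y"
    unfolding calH_delbar_eq calH_del_eq by blast
  then have "x - y \<in> aeppli_im A p q" using aeppli_class_eq_iff by metis
  then obtain u w where uw: "u \<in> im_del A p q" "w \<in> im_delbar A p q" "x - y = u + w"
    unfolding aeppli_im_eq by blast
  let ?c = "x - w"
  have c: "?c = y + u" using uw(3) by (simp add: algebra_simps)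
  have "?c \<in> ker_delbar A p q"
    using xy(1) uw(2) im_delbar_subset_ker_delbar form.subspace_diff[OF subspace_ker_delbar] by blast
  moreover have "?c \<in> ker_del A p q"
    unfolding c using xy(3) uw(1) im_del_subset_ker_del form.subspace_add[OF subspace_ker_del] by blast
  moreover have "C = aeppli_class p q ?c"
    unfolding xy(2) aeppli_class_eq_iff using uw(2) im_delbar_subset_aeppli_im by auto
  ultimately show "C \<in> aeppli_class p q ` closed_forms p q"
    by (auto simp: closed_forms_def)
qed (auto simp: calH_delbar_eq calH_del_eq closed_forms_def)

lemma presents_G_meet: "\<exists>\<pi>. presents form_scale (ker_del_class p q) (closed_mod p q) \<pi> (G_meet A p q)"
proof -
  have sub: "closed_forms p q \<subseteq> ker_del_delbar A p q" "ker_del_class p q \<subseteq> ker_del_delbar A p q"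
    using ker_delbar_subset_ker_del_delbar by (auto simp: closed_forms_def ker_del_class_def)
  have "{x \<in> ker_del_class p q. \<exists>t\<in>closed_forms p q. x - t \<in> aeppli_im A p q} = closed_mod p q"
  proof (intro equalityI subsetI)
    fix x assume "x \<in> {x \<in> ker_del_class p q. \<exists>t\<in>closed_forms p q. x - t \<in> aeppli_im A p q}"
    then obtain t u w where x: "x \<in> ker_delbar A p q" and t: "t \<in> closed_forms p q"
      and uw: "u \<in> im_del A p q" "w \<in> im_delbar A p q" "x - t = u + w"
      unfolding aeppli_im_eq ker_del_class_def by blast
    have c: "x - w = t + u" using uw(3) by (simp add: algebra_simps)
    have "x - w \<in> ker_delbar A p q"
      using x uw(2) im_delbar_subset_ker_delbar form.subspace_diff[OF subspace_ker_delbar] by blast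
    moreover have "x - w \<in> ker_del A p q"
      unfolding c by (rule form.subspace_add[OF subspace_ker_del _ subsetD[OF im_del_subset_ker_del uw(1)]])
        (use t in \<open>simp add: closed_forms_def\<close>)
    ultimately have "x - w \<in> closed_forms p q" by (simp add: closed_forms_def)
    moreover have "x = (x - w) + w" by simp
    ultimately show "x \<in> closed_mod p q" unfolding closed_mod_def using uw(2) by blast
  next
    fix x assume x: "x \<in> closed_mod p q"
    then obtain t w where tw: "t \<in> closed_forms p q" "w \<in> im_delbar A p q" "x = t + w"
      unfolding closed_mod_def by blast
    then have "x - t \<in> aeppli_im A p q" using im_delbar_subset_aeppli_im by auto
    then show "x \<in> {x \<in> ker_del_class p q. \<exists>t\<in>closed_forms p q. x - t \<in> aeppli_im A p q}"
      using x closed_mod_subset tw(1) by blast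
  qed
  then show ?thesis
    using form.presents_quotient_space[OF subspace_ker_del_delbar subspace_closed_forms sub(1)
        subspace_ker_del_class sub(2) presents_H_A]
    unfolding G_meet_def calH_delbar_inter_calG_del calH_delbar_inter_calH_del by auto
qed

lemma presents_K: "\<exists>\<pi>. presents form_scale (closed_mod p q) (exact_mod p q) \<pi> (K A p q)"
proof -
  let ?N = "{u + w | u w. u \<in> im_del A p q \<inter> ker_delbar A p q \<and> w \<in> im_delbar A p q \<inter> ker_del A p q}"
  have sub: "?N \<subseteq> closed_forms p q"
    using im_del_subset_ker_del im_delbar_subset_ker_delbar form.subspace_add[OF subspace_closed_forms]
    unfolding closed_forms_def by blast
  have N: "?N = closed_forms p q \<inter> exact_mod p q"
  proof (intro equalityI subsetI)
    fix x assume x: "x \<in> closed_forms p q \<inter> exact_mod p q"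
    then obtain u w where uw: "u \<in> im_del A p q \<inter> ker_delbar A p q" "w \<in> im_delbar A p q" "x = u + w"
      unfolding exact_mod_def by blast
    have w: "w = x - u" using uw(3) by simp
    have "x \<in> ker_del A p q" "u \<in> ker_del A p q"
      using x uw(1) im_del_subset_ker_del unfolding closed_forms_def by blast+
    then have "w \<in> ker_del A p q"
      unfolding w by (rule form.subspace_diff[OF subspace_ker_del])
    then show "x \<in> ?N" using uw by blast
  qed (use sub in \<open>auto simp: exact_mod_def\<close>)
  have "form.subspace ?N"
    by (intro form.subspace_sums form.subspace_inter subspace_im_del subspace_im_delbar
        subspace_ker_del subspace_ker_delbar)
  then have "presents form_scale (closed_forms p q) ?N (\<lambda>x. (\<lambda>w. w + x) ` ?N) (K A p q)"
    unfolding K_def set_add_forms closed_forms_def[symmetric]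
    using sub ker_del_subset by (intro presents_forms_quotient subspace_closed_forms) (auto simp: closed_forms_def)
  then have "\<exists>\<pi>. presents form_scale {c + t | c t. c \<in> closed_forms p q \<and> t \<in> exact_mod p q} (exact_mod p q) \<pi> (K A p q)"
    unfolding N by (rule form.presents_second_iso[OF subspace_closed_forms subspace_exact_mod])
  moreover have "{c + t | c t. c \<in> closed_forms p q \<and> t \<in> exact_mod p q} = closed_mod p q"
  proof (intro equalityI subsetI)
    fix x assume "x \<in> {c + t | c t. c \<in> closed_forms p q \<and> t \<in> exact_mod p q}"
    then obtain c t where "c \<in> closed_forms p q" "t \<in> exact_mod p q" "x = c + t" by blast
    moreover from this(1) have "c + 0 \<in> closed_mod p q"
      unfolding closed_mod_def using form.subspace_0[OF subspace_im_delbar] by blast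
    ultimately show "x \<in> closed_mod p q"
      using form.subspace_add[OF subspace_closed_mod, of c p q t] subsetD[OF exact_mod_subset, of t p q]
      by simp
  next
    fix x assume "x \<in> closed_mod p q"
    then show "x \<in> {c + t | c t. c \<in> closed_forms p q \<and> t \<in> exact_mod p q}"
      unfolding closed_mod_def using im_delbar_subset_exact_mod by blast
  qed
  ultimately show ?thesis by simp
qed

lemma presents_del_L: "presents form_scale (exact_mod p q) (im_delbar A p q) (dolbeault_class p q) (del_L A (p - 1) q)"
proof -
  let ?p = "p - 1"
  let ?coset = "\<lambda>x. (\<lambda>t. aeppli_class ?p q (t + x)) ` calG_forms ?p q"
  note H = presentsD[OF presents_H_A[of ?p q]]
  have "calG_del A ?p q +>\<^bsub>H_A A ?p q\<^esub> aeppli_class ?p q x = ?coset x" if "x \<in> ker_del_delbar A ?p q" for x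
    unfolding calG_del_eq a_r_coset_eq image_image
    using that by (intro image_cong refl H(2)[symmetric]) (simp_all add: calG_forms_def)
  then have L: "carrier (L_del A ?p q) = ?coset ` ker_del_delbar A ?p q"
    by (auto simp: L_del_def quotient_space_def A_RCOSETS_def' H(1)[symmetric])
  have union: "(\<Union>C\<in>?coset x. del_class A ?p q C) = dolbeault_class p q (del A x)"
    if x: "x \<in> ker_del_delbar A ?p q" for x
  proof -
    have "del_class A ?p q (aeppli_class ?p q (t + x)) = dolbeault_class p q (del A x)"
      if t: "t \<in> calG_forms ?p q" for t
    proof -
      have t': "t \<in> ker_del_delbar A ?p q" "del A t \<in> im_delbar A p q"
        using t by (auto simp: calG_forms_def)
      have "t + x \<in> ker_del_delbar A ?p q"
        by (rule form.subspace_add[OF subspace_ker_del_delbar t'(1) x])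
      then have "del_class A ?p q (aeppli_class ?p q (t + x)) = dolbeault_class p q (del A (t + x))"
        using del_class_aeppli[of "t + x" ?p q] by simp
      also have "\<dots> = dolbeault_class p q (del A x)"
        unfolding form.coset_eq_iff[OF subspace_im_delbar]
        using t' x ker_del_delbar_subset by (subst del_add) auto
      finally show ?thesis .
    qed
    moreover have "0 \<in> calG_forms ?p q"
      using form.subspace_0[OF subspace_ker_del_delbar] form.subspace_0[OF subspace_im_delbar]
      by (simp add: calG_forms_def del_zero)
    ultimately show ?thesis by auto
  qed
  have "(\<lambda>D. \<Union>C\<in>D. del_class A ?p q C) ` carrier (L_del A ?p q) =
      (\<lambda>x. dolbeault_class p q (del A x)) ` ker_del_delbar A ?p q"
    unfolding L image_image[of _ ?coset] by (rule image_cong[OF refl union])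
  also have "\<dots> = dolbeault_class p q ` (im_del A p q \<inter> ker_delbar A p q)"
  proof -
    have eq: "del A ` ker_del_delbar A ?p q = im_del A p q \<inter> ker_delbar A p q"
      using del_mem[of _ ?p q]
      by (auto simp: ker_del_delbar_eq im_del_def ker_delbar_eq del_delbar)
    show ?thesis unfolding eq[symmetric] by (simp only: image_image)
  qed
  also have "\<dots> = dolbeault_class p q ` exact_mod p q"
  proof (intro equalityI subsetI)
    fix C assume "C \<in> dolbeault_class p q ` exact_mod p q"
    then obtain u w where uw: "u \<in> im_del A p q \<inter> ker_delbar A p q" "w \<in> im_delbar A p q"
      "C = dolbeault_class p q (u + w)"
      unfolding exact_mod_def by blast
    then have "C = dolbeault_class p q u"
      by (simp add: form.coset_eq_iff[OF subspace_im_delbar])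
    then show "C \<in> dolbeault_class p q ` (im_del A p q \<inter> ker_delbar A p q)" using uw(1) by blast
  next
    fix C assume "C \<in> dolbeault_class p q ` (im_del A p q \<inter> ker_delbar A p q)"
    moreover have "im_del A p q \<inter> ker_delbar A p q \<subseteq> exact_mod p q"
    proof
      fix x assume "x \<in> im_del A p q \<inter> ker_delbar A p q"
      then have "x + 0 \<in> exact_mod p q"
        unfolding exact_mod_def using form.subspace_0[OF subspace_im_delbar] by blast
      then show "x \<in> exact_mod p q" by simp
    qed
    ultimately show "C \<in> dolbeault_class p q ` exact_mod p q" by blast
  qed
  finally have "del_L A ?p q = subspace_of (H_delbar A p q) (dolbeault_class p q ` exact_mod p q)"
    by (simp add: del_L_def)
  moreover have "exact_mod p q \<subseteq> ker_delbar A p q"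
    using exact_mod_subset closed_mod_subset by (fastforce simp: ker_del_class_def)
  ultimately show ?thesis
    using presents_subspace_of[OF presents_H_delbar] by simp
qed

end

theorem lemma5p4:
  fixes X :: "'a topology" and A :: "('a, 'n::finite) chart set" and p q :: int
  assumes "compact_complex_manifold X A"
  shows "ker_del_H_delbar A p q \<cong>\<^sub>V G_meet A p q \<oplus>\<^sub>V K A p q \<oplus>\<^sub>V del_L A (p - 1) q"
proof -
  note m = assms
  obtain \<pi> where G: "presents form_scale (ker_del_class A p q) (closed_mod A p q) \<pi> (G_meet A p q)"
    using presents_G_meet[OF m] by blast
  obtain \<rho> where K: "presents form_scale (closed_mod A p q) (exact_mod A p q) \<rho> (K A p q)"
    using presents_K[OF m] by blast
  obtain \<sigma> where KL: "presents form_scale (closed_mod A p q) (im_delbar A p q) \<sigma> (K A p q \<oplus>\<^sub>V del_L A (p - 1) q)"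
    using form.presents_direct_sum[OF subspace_closed_mod[OF m] subspace_exact_mod[OF m]
        exact_mod_subset[OF m] im_delbar_subset_exact_mod[OF m] K presents_del_L[OF m]] by blast
  have "im_delbar A p q \<subseteq> closed_mod A p q"
    using im_delbar_subset_exact_mod[OF m] exact_mod_subset[OF m] by blast
  then obtain \<tau> where "presents form_scale (ker_del_class A p q) (im_delbar A p q) \<tau>
      (G_meet A p q \<oplus>\<^sub>V K A p q \<oplus>\<^sub>V del_L A (p - 1) q)"
    using form.presents_direct_sum[OF subspace_ker_del_class[OF m] subspace_closed_mod[OF m]
        closed_mod_subset[OF m] _ G KL] by blast
  then show ?thesis
    unfolding linear_iso_def
    by (rule form.presents_iso[OF subspace_ker_del_class[OF m] presents_ker_del_H_delbar[OF m]])
qed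

end
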